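(* Let $d_E,d_S,L\ge 1$ be integers, $d_{ES}=d_Ed_S$, let $\mathcal{A}$ be a finite outcome set, $\boldsymbol a=a_1\dots a_L\in\mathcal{A}^L$, let $\rho_E^0$ and $\rho_S^0$ be density operators on $\mathbb{C}^{d_E}$ and $\mathbb{C}^{d_S}$, and let $(E_S^a)_{a\in\mathcal{A}}$ be a POVM on $\mathbb{C}^{d_S}$. Let $\omega^{\boldsymbol a}_{d_E}=\max_U p(\boldsymbol a|d_E)$ be the maximum, over all unitaries $U$ on $\mathbb{C}^{d_E}\otimes\mathbb{C}^{d_S}$, of the probability of the outcome sequence $\boldsymbol a$ in the sequential measurement protocol, and for each integer $N\ge L$ let $\tilde\omega^{\boldsymbol a,N}_{d_E}$ be the optimal value of the level-$N$ semidefinite program (both defined in the context). Then for every $N\ge L$ $$\omega^{\boldsymbol a}_{d_E}\le \tilde\omega^{\boldsymbol a,N+1}_{d_E}\le\tilde\omega^{\boldsymbol a,N}_{d_E},\qquad\text{and}\qquad \lim_{N\to\infty}\tilde\omega^{\boldsymbol a,N}_{d_E}=\omega^{\boldsymbol a}_{d_E}.$$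
   Context: Let $\mathcal H_{ES}=\mathbb{C}^{d_E}\otimes\mathbb{C}^{d_S}$ (environment and system), with fixed product orthonormal basis. Protocol. For $a\in\mathcal A$ define the measure-and-prepare map $\mathcal M_a(\rho_{ES})=\operatorname{tr}_S[\rho_{ES}(\mathbb 1_E\otimes E_S^a)]\otimes\rho_S^0$, and for a unitary $U$ on $\mathcal H_{ES}$ let $\mathcal U(\rho)=U\rho U^\dagger$. The probability of $\boldsymbol a$ is $$p(\boldsymbol a|d_E)=\operatorname{tr}\big[\mathcal M_{a_L}\circ\mathcal U\circ\cdots\circ\mathcal M_{a_1}\circ\mathcal U(\rho_E^0\otimes\rho_S^0)\big].$$ Choi matrices. For a linear map $\Lambda$ from operators on $\mathcal I$ to operators on $\mathcal O$, $\mathcal C(\Lambda)=\sum_{i,j}|i\rangle\langle j|\otimes\Lambda(|i\rangle\langle j|)$, an operator on $\mathcal I\otimes\mathcal O$. Spaces. For $\ell=1,\dots,N$ let $\mathrm I_\ell\cong\mathrm O_\ell\cong\mathcal H_{ES}$ and $\mathrm A_\ell=\mathrm I_\ell\otimes\mathrm O_\ell$; write $\mathrm A_a^b=\mathrm A_a\otimes\cdots\otimes\mathrm A_b$. Let $M_a=\mathcal C(\mathcal M_a)$; the copy $M_{a_\ell}$ is regarded as an operator with input space $\mathrm O_\ell$ and output space $\mathrm I_{\ell+1}$, i.e. acting on $\mathrm O_\ell\otimes\mathrm I_{\ell+1}$. Let $\hat M_{a}=\operatorname{tr}_{\mathcal O}[M_a]$ be its partial trace over its output space, with $\hat M_{a_L}$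 acting on $\mathrm O_L$. Define the operator on $\mathrm A_1^L$ $$X=(d_{ES})^L\,(\rho_E^0\otimes\rho_S^0)_{\mathrm I_1}\otimes M_{a_1}\otimes\cdots\otimes M_{a_{L-1}}\otimes\hat M_{a_L},$$ and let $X^{\mathrm T}$ be its transpose in the fixed basis. Symmetric projector. $P^+_N=\frac1{N!}\sum_{\sigma\in\mathfrak S_N}V_\sigma$, where $V_\sigma$ permutes the $N$ tensor factors $\mathrm A_1,\dots,\mathrm A_N$ (each of dimension $d_{ES}^2$). Level-$N$ semidefinite program ($N\ge L$). $$\tilde\omega^{\boldsymbol a,N}_{d_E}=\max_{\Phi}\ \operatorname{tr}\big[(X^{\mathrm T}\otimes\mathbb 1_{\mathrm A_{L+1}^N})\,\Phi\big]$$ over operators $\Phi$ on $\mathrm A_1^N$ subject to $\Phi\ge0$, $\operatorname{tr}[\Phi]=1$, $P^+_N\Phi=\Phi$, and $$\operatorname{tr}_{\mathrm O_1}[\Phi]=\frac{\mathbb 1_{\mathrm I_1}}{d_{ES}}\otimes\operatorname{tr}_{\mathrm A_1}[\Phi].$$ *)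

theory Defs
  imports "HOL-Analysis.Analysis" "HOL-Combinatorics.Permutations"
begin

text \<open>
  Operators on a space of fixed dimension are matrices \<^typ>\<open>complex^'n^'n\<close> in the fixed
  orthonormal basis labelled by the finite type \<^typ>\<open>'n::finite\<close>; the tensor product of two such
  spaces has the product basis, labelled by pairs.

  The number \<^term>\<open>N::nat\<close> of copies varies, so an operator on the \<^term>\<open>N\<close>-fold
  space is given by its entries \<^term>\<open>A v w\<close>, where the row and column labels are lists of
  length \<^term>\<open>N\<close>. Such an operator vanishes on all other labels, so that equations
  between operators are plain equations between functions.
\<close>

type_synonym 'i oper = "'i \<Rightarrow> 'i \<Rightarrow> complex"

definition psd_on :: "'i set \<Rightarrow> 'i oper \<Rightarrow> bool" where
  "psd_on B A \<longleftrightarrow>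
     (\<forall>x :: 'i \<Rightarrow> complex.
        (\<Sum>i\<in>B. \<Sum>j\<in>B. cnj (x i) * A i j * x j) \<in> \<real> \<and>
        Re (\<Sum>i\<in>B. \<Sum>j\<in>B. cnj (x i) * A i j * x j) \<ge> 0)"

definition psd :: "complex^'n^'n::finite \<Rightarrow> bool" where
  "psd A \<longleftrightarrow> psd_on UNIV (\<lambda>i j. A $ i $ j)"

definition density_op :: "complex^'n^'n::finite \<Rightarrow> bool" where
  "density_op \<rho> \<longleftrightarrow> psd \<rho> \<and> trace \<rho> = 1"

definition povm :: "'a set \<Rightarrow> ('a \<Rightarrow> complex^'n^'n::finite) \<Rightarrow> bool" where
  "povm \<A> E \<longleftrightarrow> finite \<A> \<and> (\<forall>a\<in>\<A>. psd (E a)) \<and> (\<Sum>a\<in>\<A>. E a) = mat 1"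

definition dagger :: "complex^'n^'m \<Rightarrow> complex^'m^'n" where
  "dagger A = (\<chi> i j. cnj (A $ j $ i))"

definition unitary :: "complex^'n^'n::finite \<Rightarrow> bool" where
  "unitary U \<longleftrightarrow> dagger U ** U = mat 1 \<and> U ** dagger U = mat 1"

definition tensor :: "complex^'m^'m \<Rightarrow> complex^'n^'n \<Rightarrow> complex^('m \<times> 'n)^('m \<times> 'n)"
    (infixr "\<otimes>\<^sub>m" 75) where
  "A \<otimes>\<^sub>m B = (\<chi> p q. A $ fst p $ fst q * B $ snd p $ snd q)"

definition tr_snd :: "complex^('m \<times> 'n::finite)^('m \<times> 'n) \<Rightarrow> complex^'m^'m" where
  "tr_snd A = (\<chi> i j. \<Sum>k\<in>UNIV. A $ (i, k) $ (j, k))"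

definition ketbra :: "'n \<Rightarrow> 'n \<Rightarrow> complex^'n^'n" where
  "ketbra i j = (\<chi> k l. if k = i \<and> l = j then 1 else 0)"

definition choi ::
    "(complex^'i^'i::finite \<Rightarrow> complex^'o^'o::finite) \<Rightarrow> complex^('i \<times> 'o)^('i \<times> 'o)" where
  "choi \<Lambda> = (\<Sum>i\<in>UNIV. \<Sum>j\<in>UNIV. ketbra i j \<otimes>\<^sub>m \<Lambda> (ketbra i j))"

definition meas_prep ::
    "complex^'s^'s \<Rightarrow> ('a \<Rightarrow> complex^'s^'s) \<Rightarrow> 'a
      \<Rightarrow> complex^('e::finite \<times> 's::finite)^('e \<times> 's) \<Rightarrow> complex^('e \<times> 's)^('e \<times> 's)" where
  "meas_prep \<rho>S E a \<rho> = tr_snd (\<rho> ** (mat 1 \<otimes>\<^sub>m E a)) \<otimes>\<^sub>m \<rho>S"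

definition conj_by :: "complex^'n^'n::finite \<Rightarrow> complex^'n^'n \<Rightarrow> complex^'n^'n" where
  "conj_by U \<rho> = U ** \<rho> ** dagger U"

text \<open>The trace below is real for density operators and a POVM; \<^const>\<open>Re\<close> only changes its type.\<close>

definition outcome_prob ::
    "complex^'e^'e::finite \<Rightarrow> complex^'s^'s::finite \<Rightarrow> ('a \<Rightarrow> complex^'s^'s) \<Rightarrow> 'a list
      \<Rightarrow> complex^('e \<times> 's)^('e \<times> 's) \<Rightarrow> real" where
  "outcome_prob \<rho>E \<rho>S E outs U =
     Re (trace (fold (\<lambda>a \<rho>. meas_prep \<rho>S E a (conj_by U \<rho>)) outs (\<rho>E \<otimes>\<^sub>m \<rho>S)))"

text \<open>Here and for the semidefinite programs, \<^const>\<open>Greatest\<close> is an attained maximum, not a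
  supremum: its value is determined only if the maximum exists.\<close>

definition omega ::
    "complex^'e^'e::finite \<Rightarrow> complex^'s^'s::finite \<Rightarrow> ('a \<Rightarrow> complex^'s^'s) \<Rightarrow> 'a list \<Rightarrow> real" where
  "omega \<rho>E \<rho>S E outs = (GREATEST r. \<exists>U. unitary U \<and> r = outcome_prob \<rho>E \<rho>S E outs U)"

definition words :: "nat \<Rightarrow> 'x list set" where
  "words N = {v. length v = N}"

definition opers :: "'i set \<Rightarrow> 'i oper set" where
  "opers B = {A. \<forall>v w. v \<notin> B \<or> w \<notin> B \<longrightarrow> A v w = 0}"

definition id_on :: "'i set \<Rightarrow> 'i oper" where
  "id_on B v w = (if v \<in> B \<and> v = w then 1 else 0)"

definition mult_on :: "'i set \<Rightarrow> 'i oper \<Rightarrow> 'i oper \<Rightarrow> 'i oper" where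
  "mult_on B A C v w = (\<Sum>u\<in>B. A v u * C u w)"

definition tr_on :: "'i set \<Rightarrow> 'i oper \<Rightarrow> complex" where
  "tr_on B A = (\<Sum>v\<in>B. A v v)"

definition oper_transpose :: "'i oper \<Rightarrow> 'i oper" where
  "oper_transpose A v w = A w v"

text \<open>Tensor product of an operator on the first \<open>L\<close> copies with one on the remaining copies.\<close>

definition tensor_append :: "nat \<Rightarrow> 'x list oper \<Rightarrow> 'x list oper \<Rightarrow> 'x list oper" where
  "tensor_append L A C v w = A (take L v) (take L w) * C (drop L v) (drop L w)"

text \<open>\<open>perm_oper N \<sigma>\<close> maps the basis vector \<open>|w\<^sub>0 \<dots> w\<^sub>N\<^sub>-\<^sub>1\<rangle>\<close> to the one whose factor number
  \<open>\<sigma> k\<close> is \<open>w\<^sub>k\<close>.\<close>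

definition perm_oper :: "nat \<Rightarrow> (nat \<Rightarrow> nat) \<Rightarrow> 'x list oper" where
  "perm_oper N \<sigma> v w = (if w \<in> words N \<and> v = permute_list (inv \<sigma>) w then 1 else 0)"

definition sym_proj :: "nat \<Rightarrow> 'x list oper" where
  "sym_proj N v w = 1 / fact N * (\<Sum>\<sigma> | \<sigma> permutes {..<N}. perm_oper N \<sigma> v w)"

text \<open>A label of one copy of \<open>A = I \<otimes> O\<close> is a pair of a label of \<open>I\<close> and one of \<open>O\<close>.\<close>

definition tr_O1 :: "('h \<times> 'h::finite) list oper \<Rightarrow> ('h \<times> ('h \<times> 'h) list) oper" where
  "tr_O1 \<Phi> p q = (\<Sum>k\<in>UNIV. \<Phi> ((fst p, k) # snd p) ((fst q, k) # snd q))"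

definition tr_A1 :: "('x::finite) list oper \<Rightarrow> 'x list oper" where
  "tr_A1 \<Phi> v w = (\<Sum>x\<in>UNIV. \<Phi> (x # v) (x # w))"

definition tensor_pair :: "'i oper \<Rightarrow> 'j oper \<Rightarrow> ('i \<times> 'j) oper" where
  "tensor_pair A C p q = A (fst p) (fst q) * C (snd p) (snd q)"

text \<open>Copies are numbered from \<open>0\<close> here: \<open>fst (v ! l)\<close> and \<open>snd (v ! l)\<close> are the labels of the
  input and output space of copy \<open>l\<close>. The Choi matrix for outcome \<open>outs ! l\<close> connects the output
  space of copy \<open>l\<close> with the input space of copy \<open>l + 1\<close>.\<close>

definition X_oper ::
    "complex^'e^'e::finite \<Rightarrow> complex^'s^'s::finite \<Rightarrow> ('a \<Rightarrow> complex^'s^'s) \<Rightarrow> 'a list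
      \<Rightarrow> (('e \<times> 's) \<times> ('e \<times> 's)) list oper" where
  "X_oper \<rho>E \<rho>S E outs v w =
     (let L = length outs;
          M = (\<lambda>a. choi (meas_prep \<rho>S E a
                 :: complex^('e \<times> 's)^('e \<times> 's) \<Rightarrow> complex^('e \<times> 's)^('e \<times> 's)))
      in if v \<in> words L \<and> w \<in> words L then
           of_nat (CARD('e) * CARD('s)) ^ L
           * (\<rho>E \<otimes>\<^sub>m \<rho>S) $ fst (v ! 0) $ fst (w ! 0)
           * (\<Prod>l<L - 1. M (outs ! l) $ (snd (v ! l), fst (v ! (l + 1)))
                                    $ (snd (w ! l), fst (w ! (l + 1))))
           * tr_snd (M (outs ! (L - 1))) $ snd (v ! (L - 1)) $ snd (w ! (L - 1))
         else 0)"

definition sdp_feasible :: "nat \<Rightarrow> ('h \<times> 'h::finite) list oper \<Rightarrow> bool" where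
  "sdp_feasible N \<Phi> \<longleftrightarrow>
     \<Phi> \<in> opers (words N) \<and>
     psd_on (words N) \<Phi> \<and>
     tr_on (words N) \<Phi> = 1 \<and>
     mult_on (words N) (sym_proj N) \<Phi> = \<Phi> \<and>
     tr_O1 \<Phi> = tensor_pair (\<lambda>i j. id_on UNIV i j / of_nat CARD('h)) (tr_A1 \<Phi>)"

text \<open>The trace below is real for feasible \<open>\<Phi>\<close>; \<^const>\<open>Re\<close> only changes its type.\<close>

definition sdp_objective ::
    "complex^'e^'e::finite \<Rightarrow> complex^'s^'s::finite \<Rightarrow> ('a \<Rightarrow> complex^'s^'s) \<Rightarrow> 'a list
      \<Rightarrow> nat \<Rightarrow> (('e \<times> 's) \<times> ('e \<times> 's)) list oper \<Rightarrow> real" where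
  "sdp_objective \<rho>E \<rho>S E outs N \<Phi> =
     (let L = length outs
      in Re (tr_on (words N)
           (mult_on (words N)
              (tensor_append L (oper_transpose (X_oper \<rho>E \<rho>S E outs)) (id_on (words (N - L)))) \<Phi>)))"

definition omega_sdp ::
    "complex^'e^'e::finite \<Rightarrow> complex^'s^'s::finite \<Rightarrow> ('a \<Rightarrow> complex^'s^'s) \<Rightarrow> 'a list \<Rightarrow> nat \<Rightarrow> real" where
  "omega_sdp \<rho>E \<rho>S E outs N =
     (GREATEST r. \<exists>\<Phi>. sdp_feasible N \<Phi> \<and> r = sdp_objective \<rho>E \<rho>S E outs N \<Phi>)"

end

theory Submission
  imports Defs
begin

text \<open>
  A feasible \<open>\<Phi>\<close> at level \<open>N\<close> is the same as the consistent family of its marginals on at most \<open>N\<close>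
  copies, so the level-\<open>N\<close> programs maximize one linear functional over decreasing compact sets,
  and their values converge to its maximum over the intersection, the families that extend to
  infinitely many copies. The latter maximum is attained at a point that in addition maximizes a
  strictly convex function. Measuring one copy decomposes such a family into families of the same
  kind, because the measured copy is one of infinitely many; strict convexity forces all of them
  to coincide, hence the family is a product \<open>R\<^sup>\<otimes>\<^sup>n\<close>. This replaces the quantum de Finetti theorem.
  Bose symmetry makes \<open>R\<close> pure, and the partial trace constraint makes it the normalized Choi state
  of a unitary, for which the functional is the outcome probability.
\<close>

section \<open>Consistent families of symmetric marginals\<close>

text \<open>Programs at different levels live on different spaces. Recording all marginals in one
  function of words of every length puts them into a single space, where bounded entries give
  compactness and the functional reads only finitely many entries. The compactness argument yields
  no rate. Measuring a copy consumes it: the pieces of a level N family are only level N - 1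
  families, about which extremality of the original says nothing. Families with all levels are
  stable under measurement, hence the passage to the intersection. The partial trace condition
  survives because it is stated beside arbitrary remaining copies. A maximizer of the functional
  with largest Hilbert-Schmidt norm at level \<open>L\<close> cannot be a proper mixture of families
  that differ at that level, and level \<open>L\<close> is all that the functional sees. Symmetry is
  imposed on row labels alone, as the projector equation demands. This is stronger than invariance
  under conjugation by permutations, and it excludes mixed R: swapping two row labels changes the
  twofold product of R unless R has rank one.\<close>

lemma finite_words [simp]: "finite (words n :: 'x::finite list set)"
  using finite_lists_length_eq[of "UNIV :: 'x set" n] by (simp add: words_def)

lemma in_words [simp]: "v \<in> words n \<longleftrightarrow> length v = n"
  by (simp add: words_def)

lemma words_0 [simp]: "words 0 = {[]}"
  by (auto simp: words_def)

lemma sum_words_Suc: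
  "(\<Sum>v\<in>words (Suc n). f v) = (\<Sum>x\<in>UNIV. \<Sum>v\<in>words n. f (x # v :: 'x::finite list))"
proof -
  have "bij_betw (\<lambda>(x, v). x # v) (UNIV \<times> words n) (words (Suc n) :: 'x list set)"
    by (rule bij_betwI[where g = "\<lambda>v. (hd v, tl v)"]) (auto simp: length_Suc_conv)
  then have "(\<Sum>v\<in>words (Suc n). f v) = (\<Sum>(x, v)\<in>UNIV \<times> words n. f (x # v))"
    by (subst sum.reindex_bij_betw[symmetric, of _ "UNIV \<times> words n"]) (auto simp: case_prod_unfold)
  then show ?thesis by (simp add: sum.cartesian_product)
qed

lemma sum_words_add:
  "(\<Sum>v\<in>words (m + n). f v) = (\<Sum>u\<in>words m. \<Sum>t\<in>words n. f (u @ t :: 'x::finite list))"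
  by (induction m arbitrary: f) (simp_all add: sum_words_Suc)

section \<open>Positive semidefinite forms: hermiticity and entry bounds\<close>

definition quad :: "'i set \<Rightarrow> 'i oper \<Rightarrow> ('i \<Rightarrow> complex) \<Rightarrow> complex" where
  "quad B A x = (\<Sum>i\<in>B. \<Sum>j\<in>B. cnj (x i) * A i j * x j)"

lemma psd_on_quad: "psd_on B A \<longleftrightarrow> (\<forall>x. quad B A x \<in> \<real> \<and> Re (quad B A x) \<ge> 0)"
  unfolding psd_on_def quad_def by (rule refl)

lemma quad_two:
  assumes "finite B" "a \<in> B" "b \<in> B" "a \<noteq> b"
  shows "quad B A (\<lambda>i. if i = a then s else if i = b then t else 0)
    = cnj s * A a a * s + cnj s * A a b * t + cnj t * A b a * s + cnj t * A b b * t"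
proof -
  let ?x = "\<lambda>i. if i = a then s else if i = b then t else (0::complex)"
  have "quad B A ?x = (\<Sum>i\<in>{a, b}. \<Sum>j\<in>B. cnj (?x i) * A i j * ?x j)"
    unfolding quad_def using assms by (intro sum.mono_neutral_right) auto
  also have "\<dots> = (\<Sum>i\<in>{a, b}. \<Sum>j\<in>{a, b}. cnj (?x i) * A i j * ?x j)"
    using assms by (intro sum.cong[OF refl] sum.mono_neutral_right) auto
  finally show ?thesis using assms by simp
qed

lemma quad_one:
  assumes "finite B" "a \<in> B"
  shows "quad B A (\<lambda>i. if i = a then 1 else 0) = A a a"
proof -
  let ?x = "\<lambda>i. if i = a then 1 else (0::complex)"
  have "quad B A ?x = (\<Sum>i\<in>{a}. \<Sum>j\<in>B. cnj (?x i) * A i j * ?x j)"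
    unfolding quad_def using assms by (intro sum.mono_neutral_right) auto
  also have "\<dots> = (\<Sum>i\<in>{a}. \<Sum>j\<in>{a}. cnj (?x i) * A i j * ?x j)"
    using assms by (intro sum.cong[OF refl] sum.mono_neutral_right) auto
  finally show ?thesis by simp
qed

lemma psd_on_diag:
  assumes "psd_on B A" "finite B" "a \<in> B"
  shows "Im (A a a) = 0" "Re (A a a) \<ge> 0"
  using assms(1) quad_one[OF assms(2,3), of A]
  unfolding psd_on_quad by (metis complex_is_Real_iff)+

text \<open>Since the diagonal is real, realness of the form at e_a + e_b makes the imaginary parts
  of the two off-diagonal entries opposite, and realness at e_a + i e_b makes their real parts
  equal.\<close>

lemma psd_on_hermitian:
  assumes "psd_on B A" "finite B" "a \<in> B" "b \<in> B"
  shows "A b a = cnj (A a b)"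
proof (cases "a = b")
  case True
  with psd_on_diag[OF assms(1-3)] show ?thesis by (simp add: complex_eq_iff)
next
  case False
  have q: "Im (cnj s * A a a * s + cnj s * A a b * t + cnj t * A b a * s + cnj t * A b b * t) = 0" for s t
    using assms(1) quad_two[OF assms(2-4) False, of A s t] unfolding psd_on_quad
    by (metis (no_types, lifting) complex_is_Real_iff)
  have "Im (A a a) = 0" "Im (A b b) = 0"
    using assms by (auto simp: psd_on_diag)
  with q[of 1 1] q[of 1 \<i>] show ?thesis by (simp add: complex_eq_iff)
qed

text \<open>A bound by the trace does not depend on the size of \<open>B\<close>; consistent
  marginals share one trace, so a single bound will serve all levels.\<close>

lemma psd_on_entry_bound:
  assumes "psd_on B A" "finite B" "a \<in> B" "b \<in> B"
  shows "norm (A a b) \<le> Re (\<Sum>i\<in>B. A i i)"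
proof (cases "a = b")
  case True
  have "norm (A a a) = Re (A a a)"
    using psd_on_diag[OF assms(1-3)] by (simp add: cmod_eq_Re)
  also have "\<dots> \<le> (\<Sum>i\<in>B. Re (A i i))"
    using assms by (intro member_le_sum) (auto simp: psd_on_diag)
  finally show ?thesis using True by simp
next
  case False
  have "2 * norm (A a b) \<le> Re (A a a) + Re (A b b)"
  proof (cases "A a b = 0")
    case True
    then show ?thesis using assms by (simp add: psd_on_diag)
  next
    case nz: False
    \<comment> \<open>This phase turns the off-diagonal terms to the negative real axis, so
      positivity at e_a + t e_b bounds twice the modulus of the entry by the two diagonal
      entries.\<close>
    define t where "t = - cnj (A a b) / of_real (norm (A a b))"
    have t: "cnj t * t = 1" "A a b * t = - of_real (norm (A a b))"
      using nz complex_norm_square[of "A a b"] by (simp_all add: t_def power2_eq_square divide_simps)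
    have "cnj t * cnj (A a b) = cnj (- of_real (norm (A a b)))"
      unfolding t(2)[symmetric] by simp
    then have t3: "cnj t * A b a = - of_real (norm (A a b))"
      using psd_on_hermitian[OF assms] by simp
    have "cnj t * A b b * t = A b b"
      using t(1) by (simp add: mult.commute mult.left_commute flip: mult.assoc)
    moreover have "Re (quad B A (\<lambda>i. if i = a then 1 else if i = b then t else 0)) \<ge> 0"
      using assms(1) by (simp add: psd_on_quad)
    ultimately show ?thesis
      using quad_two[OF assms(2-4) False, of A 1 t] by (simp only:) (simp add: t t3)
  qed
  also have "Re (A a a) + Re (A b b) = (\<Sum>i\<in>{a, b}. Re (A i i))"
    using False by simp
  also have "\<dots> \<le> (\<Sum>i\<in>B. Re (A i i))"
    using assms by (intro sum_mono2) (auto simp: psd_on_diag)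
  finally have "2 * norm (A a b) \<le> Re (\<Sum>i\<in>B. A i i)" by simp
  then show ?thesis using norm_ge_zero[of "A a b"] by linarith
qed

text \<open>
  The values of \<open>\<Psi>\<close> on words of length \<open>n\<close> are the marginal on \<open>n\<close> copies. Summing the last
  condition over \<open>i = j\<close> gives the consistency of the marginals. Words longer than \<open>N\<close> are
  unconstrained, so that the families for \<open>N + 1\<close> are among those for \<open>N\<close>.
\<close>

definition bose_family :: "nat \<Rightarrow> ('h \<times> 'h::finite) list oper \<Rightarrow> bool" where
  "bose_family N \<Psi> \<longleftrightarrow>
     (\<forall>v w. length v \<noteq> length w \<longrightarrow> \<Psi> v w = 0) \<and>
     (\<forall>n\<le>N. psd_on (words n) \<Psi>) \<and>
     (\<forall>v v' w. length v \<le> N \<longrightarrow> mset v' = mset v \<longrightarrow> \<Psi> v' w = \<Psi> v w) \<and>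
     (\<forall>i j v w. length v < N \<longrightarrow>
        (\<Sum>k\<in>UNIV. \<Psi> ((i, k) # v) ((j, k) # w)) = (if i = j then \<Psi> v w / of_nat CARD('h) else 0))"

lemma sum_pair: "(\<Sum>x\<in>UNIV. f (x :: 'a::finite \<times> 'b::finite)) = (\<Sum>i\<in>UNIV. \<Sum>k\<in>UNIV. f (i, k))"
  unfolding UNIV_Times_UNIV[symmetric] sum.cartesian_product by simp

context
  fixes N :: nat and \<Psi> :: "('h \<times> 'h::finite) list oper"
  assumes fam: "bose_family N \<Psi>"
begin

lemma bose_family_length: "length v \<noteq> length w \<Longrightarrow> \<Psi> v w = 0"
  using fam unfolding bose_family_def by blast

lemma bose_family_psd: "n \<le> N \<Longrightarrow> psd_on (words n) \<Psi>"
  using fam unfolding bose_family_def by blast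

lemma bose_family_perm1: "length v \<le> N \<Longrightarrow> mset v' = mset v \<Longrightarrow> \<Psi> v' w = \<Psi> v w"
  using fam unfolding bose_family_def by blast

lemma bose_family_constraint:
  "length v < N \<Longrightarrow>
   (\<Sum>k\<in>UNIV. \<Psi> ((i, k) # v) ((j, k) # w)) = (if i = j then \<Psi> v w / of_nat CARD('h) else 0)"
  using fam unfolding bose_family_def by blast

lemma bose_family_hermitian:
  assumes "length v \<le> N" shows "\<Psi> w v = cnj (\<Psi> v w)"
proof (cases "length v = length w")
  case True
  with psd_on_hermitian[OF bose_family_psd[OF assms], of v w] show ?thesis by simp
qed (simp add: bose_family_length)

text \<open>The definition permutes row labels only; hermiticity carries the symmetry over to the
  column labels, with an independent permutation.\<close>

lemma bose_family_perm:
  assumes "length v \<le> N" "mset v' = mset v" "mset w' = mset w"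
  shows "\<Psi> v' w' = \<Psi> v w"
proof (cases "length v = length w")
  case True
  have len: "length w = length w'" using assms(3) by (metis size_mset)
  have "\<Psi> v w' = cnj (\<Psi> w' v)"
    using True assms len by (intro bose_family_hermitian) simp
  also have "\<Psi> w' v = \<Psi> w v"
    using True assms by (intro bose_family_perm1) simp_all
  also have "cnj (\<Psi> w v) = \<Psi> v w"
    using True assms by (intro bose_family_hermitian[symmetric]) simp
  finally show ?thesis using assms by (simp add: bose_family_perm1[of v v'])
next
  case False
  then have "length v' \<noteq> length w'" using assms by (metis size_mset)
  with False show ?thesis by (simp add: bose_family_length)
qed

lemma bose_family_tr_A1:
  assumes "length v < N" shows "(\<Sum>x\<in>UNIV. \<Psi> (x # v) (x # w)) = \<Psi> v w"
  using assms by (simp add: sum_pair bose_family_constraint)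

text \<open>The defining condition traces out a first copy, marginals trace out trailing ones;
  symmetry moves the traced label to the front.\<close>

lemma bose_family_marginal:
  "length u + n \<le> N \<Longrightarrow> (\<Sum>t\<in>words n. \<Psi> (u @ t) (v @ t)) = \<Psi> u v"
proof (induction n arbitrary: u v)
  case (Suc n)
  have "(\<Sum>t\<in>words (Suc n). \<Psi> (u @ t) (v @ t)) = (\<Sum>x\<in>UNIV. \<Sum>t\<in>words n. \<Psi> (u @ x # t) (v @ x # t))"
    by (simp add: sum_words_Suc)
  also have "\<dots> = (\<Sum>x\<in>UNIV. \<Sum>t\<in>words n. \<Psi> ((x # u) @ t) ((x # v) @ t))"
    using Suc.prems by (intro sum.cong refl bose_family_perm) auto
  also have "\<dots> = (\<Sum>x\<in>UNIV. \<Psi> (x # u) (x # v))"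
    using Suc.prems by (subst Suc.IH) auto
  also have "\<dots> = \<Psi> u v"
    using Suc.prems by (intro bose_family_tr_A1) auto
  finally show ?case .
qed simp

lemma bose_family_trace: "n \<le> N \<Longrightarrow> (\<Sum>t\<in>words n. \<Psi> t t) = \<Psi> [] []"
  using bose_family_marginal[of "[]" n "[]"] by simp

lemma bose_family_bound:
  assumes "length v \<le> N" shows "norm (\<Psi> v w) \<le> Re (\<Psi> [] [])"
proof (cases "length v = length w")
  case True
  have "norm (\<Psi> v w) \<le> Re (\<Sum>t\<in>words (length v). \<Psi> t t)"
    using True by (intro psd_on_entry_bound bose_family_psd assms) auto
  then show ?thesis using assms by (simp add: bose_family_trace)
next
  case False
  then show ?thesis
    using psd_on_diag(2)[OF bose_family_psd[of 0], of "[]"] by (simp add: bose_family_length)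
qed

lemma bose_family_mono: "M \<le> N \<Longrightarrow> bose_family M \<Psi>"
  using fam unfolding bose_family_def by (meson le_trans less_le_trans)

lemma bose_family_scale:
  assumes "c \<ge> 0" shows "bose_family N (\<lambda>v w. of_real c * \<Psi> v w)"
proof -
  have q: "quad B (\<lambda>v w. of_real c * \<Psi> v w) x = of_real c * quad B \<Psi> x" for B x
    by (simp add: quad_def sum_distrib_left algebra_simps)
  have "psd_on (words n) (\<lambda>v w. of_real c * \<Psi> v w)" if "n \<le> N" for n
    using bose_family_psd[OF that] assms unfolding psd_on_quad q by simp
  moreover have "(\<Sum>k\<in>UNIV. of_real c * \<Psi> ((i, k) # v) ((j, k) # w))
      = (if i = j then of_real c * \<Psi> v w / of_nat CARD('h) else 0)" if "length v < N" for i j v w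
    using that by (simp add: bose_family_constraint flip: sum_distrib_left)
  moreover have "of_real c * \<Psi> v' w = of_real c * \<Psi> v w"
    if "length v \<le> N" "mset v' = mset v" for v v' w
    using bose_family_perm1[OF that] by simp
  moreover have "of_real c * \<Psi> v w = 0" if "length v \<noteq> length w" for v w
    using bose_family_length[OF that] by simp
  ultimately show ?thesis unfolding bose_family_def by blast
qed

end

lemma bose_family_sum:
  fixes \<Psi> :: "'a \<Rightarrow> ('h \<times> 'h::finite) list oper"
  assumes "\<And>a. a \<in> I \<Longrightarrow> bose_family N (\<Psi> a)"
  shows "bose_family N (\<lambda>v w. \<Sum>a\<in>I. \<Psi> a v w)"
proof -
  have q: "quad B (\<lambda>v w. \<Sum>a\<in>I. \<Psi> a v w) x = (\<Sum>a\<in>I. quad B (\<Psi> a) x)" for B x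
  proof -
    have "quad B (\<lambda>v w. \<Sum>a\<in>I. \<Psi> a v w) x
        = (\<Sum>v\<in>B. \<Sum>w\<in>B. \<Sum>a\<in>I. cnj (x v) * \<Psi> a v w * x w)"
      by (simp add: quad_def sum_distrib_left sum_distrib_right)
    also have "\<dots> = (\<Sum>v\<in>B. \<Sum>a\<in>I. \<Sum>w\<in>B. cnj (x v) * \<Psi> a v w * x w)"
      by (intro sum.cong refl sum.swap)
    also have "\<dots> = (\<Sum>a\<in>I. quad B (\<Psi> a) x)"
      unfolding quad_def by (rule sum.swap)
    finally show ?thesis .
  qed
  have "psd_on (words n) (\<lambda>v w. \<Sum>a\<in>I. \<Psi> a v w)" if "n \<le> N" for n
    using bose_family_psd[OF assms that] unfolding psd_on_quad q
    by (auto intro!: sum_nonneg)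
  moreover have "(\<Sum>k\<in>UNIV. \<Sum>a\<in>I. \<Psi> a ((i, k) # v) ((j, k) # w))
      = (if i = j then (\<Sum>a\<in>I. \<Psi> a v w) / of_nat CARD('h) else 0)" if "length v < N" for i j v w
    using that by (subst sum.swap) (auto simp: bose_family_constraint[OF assms] sum_divide_distrib)
  moreover have "(\<Sum>a\<in>I. \<Psi> a v' w) = (\<Sum>a\<in>I. \<Psi> a v w)" if "length v \<le> N" "mset v' = mset v" for v v' w
    using that by (intro sum.cong refl bose_family_perm1[OF assms]) auto
  moreover have "(\<Sum>a\<in>I. \<Psi> a v w) = 0" if "length v \<noteq> length w" for v w
    using that by (intro sum.neutral ballI bose_family_length[OF assms]) auto
  ultimately show ?thesis unfolding bose_family_def by blast
qed

lemma sum_swap4: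
  "(\<Sum>v\<in>A. \<Sum>w\<in>B. \<Sum>x\<in>C. \<Sum>y\<in>D. f v w x y) = (\<Sum>x\<in>C. \<Sum>v\<in>A. \<Sum>y\<in>D. \<Sum>w\<in>B. f v w x y)"
proof -
  have "(\<Sum>v\<in>A. \<Sum>w\<in>B. \<Sum>x\<in>C. \<Sum>y\<in>D. f v w x y) = (\<Sum>v\<in>A. \<Sum>x\<in>C. \<Sum>w\<in>B. \<Sum>y\<in>D. f v w x y)"
    by (intro sum.cong refl sum.swap)
  also have "\<dots> = (\<Sum>x\<in>C. \<Sum>v\<in>A. \<Sum>w\<in>B. \<Sum>y\<in>D. f v w x y)"
    by (rule sum.swap)
  also have "\<dots> = (\<Sum>x\<in>C. \<Sum>v\<in>A. \<Sum>y\<in>D. \<Sum>w\<in>B. f v w x y)"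
    by (intro sum.cong refl sum.swap)
  finally show ?thesis .
qed

text \<open>Conditioning on an outcome with effect \<open>|g\<rangle>\<langle>g|\<close> measured on the first copy.\<close>

definition condition :: "('x::finite \<Rightarrow> complex) \<Rightarrow> 'x list oper \<Rightarrow> 'x list oper" where
  "condition g \<Psi> v w = (\<Sum>x\<in>UNIV. \<Sum>y\<in>UNIV. cnj (g x) * \<Psi> (x # v) (y # w) * g y)"

text \<open>The drop from \<open>Suc N\<close> to \<open>N\<close> is the copy used up by the
  measurement. The partial trace condition concerns another copy, so by symmetry it can be applied
  while the measured label sits among the remaining ones.\<close>

lemma bose_family_condition:
  assumes fam: "bose_family (Suc N) \<Psi>"
  shows "bose_family N (condition g \<Psi>)"
proof -
  have "psd_on (words n) (condition g \<Psi>)" if "n \<le> N" for n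
  proof -
    \<comment> \<open>Positivity after conditioning is positivity before it, tested on the product
      vector of \<open>g\<close> and \<open>u\<close>.\<close>
    have q: "quad (words n) (condition g \<Psi>) u
        = quad (words (Suc n)) \<Psi> (\<lambda>v. g (hd v) * u (tl v))" for u
    proof -
      have "quad (words n) (condition g \<Psi>) u = (\<Sum>v\<in>words n. \<Sum>w\<in>words n. \<Sum>x\<in>UNIV. \<Sum>y\<in>UNIV.
         cnj (g x * u v) * \<Psi> (x # v) (y # w) * (g y * u w))"
        by (simp add: quad_def condition_def sum_distrib_left sum_distrib_right mult_ac)
      also have "\<dots> = (\<Sum>x\<in>UNIV. \<Sum>v\<in>words n. \<Sum>y\<in>UNIV. \<Sum>w\<in>words n. 
         cnj (g x * u v) * \<Psi> (x # v) (y # w) * (g y * u w))"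
        by (rule sum_swap4)
      finally show ?thesis by (simp add: quad_def sum_words_Suc)
    qed
    show ?thesis
      using bose_family_psd[OF fam, of "Suc n"] that unfolding psd_on_quad q by simp
  qed
  moreover have "(\<Sum>k\<in>UNIV. condition g \<Psi> ((i, k) # v) ((j, k) # w))
      = (if i = j then condition g \<Psi> v w / of_nat CARD('a) else 0)" if "length v < N" for i j v w
  proof -
    have "(\<Sum>k\<in>UNIV. condition g \<Psi> ((i, k) # v) ((j, k) # w))
        = (\<Sum>k\<in>UNIV. \<Sum>x\<in>UNIV. \<Sum>y\<in>UNIV. cnj (g x) * \<Psi> ((i, k) # x # v) ((j, k) # y # w) * g y)"
      unfolding condition_def using that
      by (intro sum.cong refl arg_cong2[where f = "(*)"] bose_family_perm[OF fam]) auto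
    also have "\<dots> = (\<Sum>x\<in>UNIV. \<Sum>y\<in>UNIV. cnj (g x) * (\<Sum>k\<in>UNIV. \<Psi> ((i, k) # x # v) ((j, k) # y # w)) * g y)"
      by (simp only: sum_distrib_left sum_distrib_right)
        (subst sum.swap, intro sum.cong refl sum.swap)
    also have "\<dots> = (if i = j then condition g \<Psi> v w / of_nat CARD('a) else 0)"
      using that by (simp add: bose_family_constraint[OF fam] condition_def sum_divide_distrib)
    finally show ?thesis .
  qed
  moreover have "condition g \<Psi> v' w = condition g \<Psi> v w" if "length v \<le> N" "mset v' = mset v" for v v' w
    unfolding condition_def using that
    by (intro sum.cong refl arg_cong2[where f = "(*)"] bose_family_perm[OF fam]) auto
  moreover have "condition g \<Psi> v w = 0" if "length v \<noteq> length w" for v w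
    using that by (simp add: condition_def bose_family_length[OF fam])
  ultimately show ?thesis unfolding bose_family_def by blast
qed

section \<open>Feasible points as families\<close>

lemma mult_sym_proj:
  fixes \<Phi> :: "'x::finite list oper"
  assumes "length v = N"
  shows "mult_on (words N) (sym_proj N) \<Phi> v w
    = (\<Sum>\<sigma> | \<sigma> permutes {..<N}. \<Phi> (permute_list \<sigma> v) w) / fact N"
proof -
  have *: "(\<Sum>u\<in>words N. perm_oper N \<sigma> v u * \<Phi> u w) = \<Phi> (permute_list \<sigma> v) w"
    if \<sigma>: "\<sigma> permutes {..<N}" for \<sigma>
  proof -
    have "v = permute_list (inv \<sigma>) u \<longleftrightarrow> u = permute_list \<sigma> v" if u: "length u = N" for u
    proof -
      have "permute_list \<sigma> (permute_list (inv \<sigma>) u) = u"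
        using \<sigma> u permute_list_compose[of \<sigma> u "inv \<sigma>"] by (simp add: permutes_inv_o)
      moreover have "permute_list (inv \<sigma>) (permute_list \<sigma> v) = v"
        using \<sigma> assms permute_list_compose[of "inv \<sigma>" v \<sigma>]
        by (simp add: permutes_inv_o permutes_inv)
      ultimately show ?thesis by auto
    qed
    then have "(\<Sum>u\<in>words N. perm_oper N \<sigma> v u * \<Phi> u w)
        = (\<Sum>u\<in>words N. if u = permute_list \<sigma> v then \<Phi> u w else 0)"
      by (intro sum.cong) (auto simp: perm_oper_def)
    also have "\<dots> = \<Phi> (permute_list \<sigma> v) w"
      using assms by simp
    finally show ?thesis .
  qed
  have "mult_on (words N) (sym_proj N) \<Phi> v w
      = (\<Sum>\<sigma> | \<sigma> permutes {..<N}. \<Sum>u\<in>words N. perm_oper N \<sigma> v u * \<Phi> u w) / fact N"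
    by (subst sum.swap) (simp add: mult_on_def sym_proj_def sum_distrib_right sum_divide_distrib)
  then show ?thesis by (simp add: *)
qed

text \<open>The range of the symmetric projector consists of the vectors fixed by all permutations,
  here applied to the columns of \<open>\<Phi>\<close>. One direction reindexes the average by left
  translation, the other averages a constant.\<close>

lemma sym_proj_fixed_iff:
  fixes \<Phi> :: "'x::finite list oper"
  assumes "\<Phi> \<in> opers (words N)"
  shows "mult_on (words N) (sym_proj N) \<Phi> = \<Phi> \<longleftrightarrow>
    (\<forall>v v' w :: 'x list. length v = N \<longrightarrow> mset v' = mset v \<longrightarrow> \<Phi> v' w = \<Phi> v w)"
proof (intro iffI allI impI)
  fix v v' w :: "'x list"
  assume fixed: "mult_on (words N) (sym_proj N) \<Phi> = \<Phi>" and v: "length v = N" "mset v' = mset v"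
  obtain p where p: "p permutes {..<length v}" "permute_list p v = v'"
    using mset_eq_permutation[OF v(2)] by blast
  have "\<Phi> v' w = mult_on (words N) (sym_proj N) \<Phi> v' w"
    by (simp add: fixed)
  also have "\<dots> = (\<Sum>\<sigma> | \<sigma> permutes {..<N}. \<Phi> (permute_list \<sigma> v') w) / fact N"
    using v by (metis mult_sym_proj size_mset)
  also have "\<dots> = (\<Sum>\<sigma> | \<sigma> permutes {..<N}. \<Phi> (permute_list (p \<circ> \<sigma>) v) w) / fact N"
    using v(1) by (simp add: permute_list_compose p(2))
  also have "\<dots> = (\<Sum>\<sigma> | \<sigma> permutes {..<N}. \<Phi> (permute_list \<sigma> v) w) / fact N"
    using p(1) v(1)
    by (intro arg_cong[where f = "\<lambda>z. z / fact N"]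
        setum_permutations_compose_left[where f = "\<lambda>\<sigma>. \<Phi> (permute_list \<sigma> v) w", symmetric]) simp
  also have "\<dots> = \<Phi> v w"
    using v(1) mult_sym_proj[of v N \<Phi> w] by (simp add: fixed)
  finally show "\<Phi> v' w = \<Phi> v w" .
next
  assume perm: "\<forall>v v' w :: 'x list. length v = N \<longrightarrow> mset v' = mset v \<longrightarrow> \<Phi> v' w = \<Phi> v w"
  show "mult_on (words N) (sym_proj N) \<Phi> = \<Phi>"
  proof (intro ext)
    fix v w
    show "mult_on (words N) (sym_proj N) \<Phi> v w = \<Phi> v w"
    proof (cases "length v = N")
      case True
      have "(\<Sum>\<sigma> | \<sigma> permutes {..<N}. \<Phi> (permute_list \<sigma> v) w) = (\<Sum>\<sigma> | \<sigma> permutes {..<N}. \<Phi> v w)"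
      proof (rule sum.cong[OF refl])
        fix \<sigma> assume "\<sigma> \<in> {\<sigma>. \<sigma> permutes {..<N}}"
        then have "mset (permute_list \<sigma> v) = mset v" using True by simp
        then show "\<Phi> (permute_list \<sigma> v) w = \<Phi> v w" using perm True by blast
      qed
      then show ?thesis
        using True by (simp add: mult_sym_proj card_permutations)
    next
      case False
      then have "perm_oper N \<sigma> v u = 0" for \<sigma> u
        by (auto simp: perm_oper_def)
      then show ?thesis
        using False assms by (simp add: mult_on_def sym_proj_def opers_def)
    qed
  qed
qed

text \<open>Subtraction is truncated, so at words longer than \<open>N\<close> the entry is that of
  \<open>\<Phi>\<close> itself, which is zero for an operator on \<open>N\<close> copies.\<close>

definition marginals :: "nat \<Rightarrow> 'x list oper \<Rightarrow> 'x list oper" where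
  "marginals N \<Phi> v w = (\<Sum>t\<in>words (N - length v). \<Phi> (v @ t) (w @ t))"

definition restrict_level :: "nat \<Rightarrow> 'x list oper \<Rightarrow> 'x list oper" where
  "restrict_level N \<Psi> v w = (if v \<in> words N \<and> w \<in> words N then \<Psi> v w else 0)"

text \<open>The form of a partial trace at \<open>x\<close> is the sum over basis words
  \<open>t\<close> of the form of \<open>\<Phi>\<close> at the product of \<open>x\<close> with the
  basis vector of \<open>t\<close>.\<close>

lemma psd_on_marginals:
  fixes \<Phi> :: "'x::finite list oper"
  assumes "psd_on (words N) \<Phi>" "n \<le> N"
  shows "psd_on (words n) (marginals N \<Phi>)"
proof -
  define m where "m = N - n"
  have N: "N = n + m" using assms(2) by (simp add: m_def)
  have q: "quad (words n) (marginals N \<Phi>) x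
      = (\<Sum>t\<in>words m. quad (words N) \<Phi> (\<lambda>u. if drop n u = t then x (take n u) else 0))" for x
  proof -
    have "quad (words N) \<Phi> (\<lambda>u. if drop n u = t then x (take n u) else 0)
        = (\<Sum>v\<in>words n. \<Sum>w\<in>words n. cnj (x v) * \<Phi> (v @ t) (w @ t) * x w)"
      if t: "t \<in> words m" for t
    proof -
      have "quad (words N) \<Phi> (\<lambda>u. if drop n u = t then x (take n u) else 0)
        = (\<Sum>v\<in>words n. \<Sum>s\<in>words m. \<Sum>w\<in>words n. \<Sum>r\<in>words m.
            if r = t then if s = t then cnj (x v) * \<Phi> (v @ s) (w @ r) * x w else 0 else 0)"
        unfolding quad_def N sum_words_add by (intro sum.cong refl) auto
      also have "\<dots> = (\<Sum>v\<in>words n. \<Sum>s\<in>words m.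
            if s = t then \<Sum>w\<in>words n. cnj (x v) * \<Phi> (v @ s) (w @ t) * x w else 0)"
        using t by (intro sum.cong refl) simp
      also have "\<dots> = (\<Sum>v\<in>words n. \<Sum>w\<in>words n. cnj (x v) * \<Phi> (v @ t) (w @ t) * x w)"
        using t by simp
      finally show ?thesis .
    qed
    then have "(\<Sum>t\<in>words m. quad (words N) \<Phi> (\<lambda>u. if drop n u = t then x (take n u) else 0))
       = (\<Sum>t\<in>words m. \<Sum>v\<in>words n. \<Sum>w\<in>words n. cnj (x v) * \<Phi> (v @ t) (w @ t) * x w)"
      by (intro sum.cong refl)
    also have "\<dots> = (\<Sum>v\<in>words n. \<Sum>t\<in>words m. \<Sum>w\<in>words n. cnj (x v) * \<Phi> (v @ t) (w @ t) * x w)"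
      by (rule sum.swap)
    also have "\<dots> = (\<Sum>v\<in>words n. \<Sum>w\<in>words n. \<Sum>t\<in>words m. cnj (x v) * \<Phi> (v @ t) (w @ t) * x w)"
      by (intro sum.cong refl sum.swap)
    also have "\<dots> = quad (words n) (marginals N \<Phi>) x"
      unfolding quad_def
      by (intro sum.cong refl) (simp add: marginals_def m_def sum_distrib_left sum_distrib_right)
    finally show ?thesis by (rule sym)
  qed
  show ?thesis
    using assms(1) unfolding psd_on_quad q by (auto intro!: sum_nonneg)
qed

text \<open>The program imposes the partial trace condition at level \<open>N\<close> only; tracing
  out trailing copies passes it down to all lower levels.\<close>

lemma bose_family_marginals:
  fixes \<Phi> :: "('h \<times> 'h::finite) list oper"
  assumes feas: "sdp_feasible N \<Phi>" and "N \<ge> 1"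
  shows "bose_family N (marginals N \<Phi>)"
proof -
  have opers: "\<Phi> \<in> opers (words N)" and psd: "psd_on (words N) \<Phi>"
    and sym: "mult_on (words N) (sym_proj N) \<Phi> = \<Phi>"
    and tr: "tr_O1 \<Phi> = tensor_pair (\<lambda>i j. id_on UNIV i j / of_nat CARD('h)) (tr_A1 \<Phi>)"
    using feas by (auto simp: sdp_feasible_def)
  have perm: "\<Phi> v' w = \<Phi> v w" if "length v = N" "mset v' = mset v" for v v' w
    using iffD1[OF sym_proj_fixed_iff[OF opers] sym] that by blast
  have herm: "\<Phi> w v = cnj (\<Phi> v w)" for v w
  proof (cases "v \<in> words N \<and> w \<in> words N")
    case True
    then show ?thesis by (intro psd_on_hermitian[OF psd]) auto
  next
    case False
    then have "\<Phi> w v = 0" "\<Phi> v w = 0" using opers by (auto simp: opers_def)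
    then show ?thesis by simp
  qed
  have perm2: "\<Phi> v' w' = \<Phi> v w" if "length v = N" "length w = N" "mset v' = mset v" "mset w' = mset w"
    for v v' w w'
    using that perm[of v v' w'] perm[of w w' v] herm[of w' v] herm[of w v] by simp
  have "marginals N \<Phi> v w = 0" if "length v \<noteq> length w" for v w
    unfolding marginals_def
  proof (intro sum.neutral ballI)
    fix t :: "('h \<times> 'h) list" assume "t \<in> words (N - length v)"
    with that have "v @ t \<notin> words N \<or> w @ t \<notin> words N" by auto
    with opers show "\<Phi> (v @ t) (w @ t) = 0" unfolding opers_def by blast
  qed
  moreover have "marginals N \<Phi> v' w = marginals N \<Phi> v w"
    if "length v \<le> N" "mset v' = mset v" for v v' w
  proof -
    have "length v' = length v" using that(2) by (metis size_mset)
    then show ?thesis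
      unfolding marginals_def using that by (intro sum.cong perm) auto
  qed
  moreover have "(\<Sum>k\<in>UNIV. marginals N \<Phi> ((i, k) # v) ((j, k) # w))
      = (if i = j then marginals N \<Phi> v w / of_nat CARD('h) else 0)" if v: "length v < N" for i j v w
  proof (cases "length v = length w")
    case True
    obtain m where m: "N - length v = Suc m" using v by (cases "N - length v") auto
    then have m': "N - Suc (length v) = m" by simp
    have "(\<Sum>k\<in>UNIV. marginals N \<Phi> ((i, k) # v) ((j, k) # w))
        = (\<Sum>t\<in>words m. \<Sum>k\<in>UNIV. \<Phi> ((i, k) # v @ t) ((j, k) # w @ t))"
      by (simp only: marginals_def list.size m' add_Suc_right add_0_right append_Cons) (rule sum.swap)
    also have "\<dots> = (\<Sum>t\<in>words m. if i = j then tr_A1 \<Phi> (v @ t) (w @ t) / of_nat CARD('h) else 0)"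
    proof (rule sum.cong[OF refl])
      fix t
      have "(\<Sum>k\<in>UNIV. \<Phi> ((i, k) # v @ t) ((j, k) # w @ t)) = tr_O1 \<Phi> (i, v @ t) (j, w @ t)"
        by (simp add: tr_O1_def)
      also have "\<dots> = (if i = j then tr_A1 \<Phi> (v @ t) (w @ t) / of_nat CARD('h) else 0)"
        unfolding tr by (simp add: tensor_pair_def id_on_def)
      finally show "(\<Sum>k\<in>UNIV. \<Phi> ((i, k) # v @ t) ((j, k) # w @ t))
          = (if i = j then tr_A1 \<Phi> (v @ t) (w @ t) / of_nat CARD('h) else 0)" .
    qed
    also have "\<dots> = (if i = j then (\<Sum>t\<in>words m. tr_A1 \<Phi> (v @ t) (w @ t)) / of_nat CARD('h) else 0)"
      by (simp add: sum_divide_distrib)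
    also have "(\<Sum>t\<in>words m. tr_A1 \<Phi> (v @ t) (w @ t))
        = (\<Sum>x\<in>UNIV. \<Sum>t\<in>words m. \<Phi> (x # v @ t) (x # w @ t))"
      unfolding tr_A1_def by (rule sum.swap)
    \<comment> \<open>The label traced by \<open>tr_A1\<close> joins the trailing trace and supplies
      the missing letter of a word of length \<open>Suc m\<close>.\<close>
    also have "\<dots> = (\<Sum>x\<in>UNIV. \<Sum>t\<in>words m. \<Phi> (v @ x # t) (w @ x # t))"
      using m True by (intro sum.cong refl perm2) auto
    also have "\<dots> = marginals N \<Phi> v w"
      by (simp add: marginals_def m sum_words_Suc)
    finally show ?thesis .
  next
    case False
    then show ?thesis by (simp add: calculation(1))
  qed
  ultimately show ?thesis
    unfolding bose_family_def using psd_on_marginals[OF psd] by blast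
qed

lemma sdp_feasible_restrict_level:
  fixes \<Psi> :: "('h \<times> 'h::finite) list oper"
  assumes fam: "bose_family N \<Psi>" and "\<Psi> [] [] = 1" and "N \<ge> 1"
  shows "sdp_feasible N (restrict_level N \<Psi>)"
proof -
  let ?\<Phi> = "restrict_level N \<Psi>"
  have opers: "?\<Phi> \<in> opers (words N)"
    by (auto simp: opers_def restrict_level_def)
  have "quad (words N) ?\<Phi> x = quad (words N) \<Psi> x" for x
    by (simp add: quad_def restrict_level_def)
  then have "psd_on (words N) ?\<Phi>"
    using bose_family_psd[OF fam, of N] by (simp add: psd_on_quad)
  moreover have "tr_on (words N) ?\<Phi> = 1"
    using bose_family_trace[OF fam, of N] assms(2) by (simp add: tr_on_def restrict_level_def)
  moreover have "mult_on (words N) (sym_proj N) ?\<Phi> = ?\<Phi>"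
    unfolding sym_proj_fixed_iff[OF opers]
  proof (intro allI impI)
    fix v v' w :: "('h \<times> 'h) list" assume v: "length v = N" "mset v' = mset v"
    moreover have "length v' = N" using v by (metis size_mset)
    ultimately show "?\<Phi> v' w = ?\<Phi> v w"
      using bose_family_perm1[OF fam, of v v'] by (simp add: restrict_level_def)
  qed
  moreover have "tr_O1 ?\<Phi> p q = tensor_pair (\<lambda>i j. id_on UNIV i j / of_nat CARD('h)) (tr_A1 ?\<Phi>) p q"
    for p q
  proof (cases "Suc (length (snd p)) = N \<and> Suc (length (snd q)) = N")
    case True
    then have "tr_O1 ?\<Phi> p q = (if fst p = fst q then \<Psi> (snd p) (snd q) / of_nat CARD('h) else 0)"
      by (simp add: tr_O1_def restrict_level_def bose_family_constraint[OF fam])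
    moreover have "tr_A1 ?\<Phi> (snd p) (snd q) = \<Psi> (snd p) (snd q)"
      using True by (simp add: tr_A1_def restrict_level_def bose_family_tr_A1[OF fam])
    ultimately show ?thesis by (simp add: tensor_pair_def id_on_def)
  next
    case False
    then show ?thesis by (auto simp: tr_O1_def tr_A1_def tensor_pair_def restrict_level_def)
  qed
  ultimately show ?thesis
    using opers unfolding sdp_feasible_def by blast
qed

text \<open>The transpose in the program turns the trace of a product into this entrywise pairing
  without conjugation. Only words of the length of \<open>outs\<close> occur, so the functional is
  the same at every level.\<close>

definition family_value ::
    "complex^'e^'e::finite \<Rightarrow> complex^'s^'s::finite \<Rightarrow> ('a \<Rightarrow> complex^'s^'s) \<Rightarrow> 'a list
      \<Rightarrow> (('e \<times> 's) \<times> ('e \<times> 's)) list oper \<Rightarrow> real" where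
  "family_value \<rho>E \<rho>S E outs \<Psi> =
     Re (\<Sum>u\<in>words (length outs). \<Sum>v\<in>words (length outs). X_oper \<rho>E \<rho>S E outs u v * \<Psi> u v)"

lemma sdp_objective_marginals:
  assumes "length outs \<le> N"
  shows "sdp_objective \<rho>E \<rho>S E outs N \<Phi> = family_value \<rho>E \<rho>S E outs (marginals N \<Phi>)"
proof -
  define L m where "L = length outs" and "m = N - L"
  have N: "N = L + m" using assms by (simp add: L_def m_def)
  let ?X = "X_oper \<rho>E \<rho>S E outs"
  have "tr_on (words N) (mult_on (words N) (tensor_append L (oper_transpose ?X) (id_on (words m))) \<Phi>)
    = (\<Sum>v\<in>words L. \<Sum>s\<in>words m. \<Sum>u\<in>words L. \<Sum>t\<in>words m. 
        if s = t then ?X u v * \<Phi> (u @ t) (v @ s) else 0)"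
    unfolding tr_on_def mult_on_def N sum_words_add tensor_append_def oper_transpose_def id_on_def
    by (intro sum.cong refl) auto
  also have "\<dots> = (\<Sum>v\<in>words L. \<Sum>s\<in>words m. \<Sum>u\<in>words L. ?X u v * \<Phi> (u @ s) (v @ s))"
    by (intro sum.cong refl) simp
  also have "\<dots> = (\<Sum>v\<in>words L. \<Sum>u\<in>words L. \<Sum>s\<in>words m. ?X u v * \<Phi> (u @ s) (v @ s))"
    by (intro sum.cong refl sum.swap)
  also have "\<dots> = (\<Sum>u\<in>words L. \<Sum>v\<in>words L. \<Sum>s\<in>words m. ?X u v * \<Phi> (u @ s) (v @ s))"
    by (rule sum.swap)
  also have "\<dots> = (\<Sum>u\<in>words L. \<Sum>v\<in>words L. ?X u v * marginals N \<Phi> u v)"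
    by (intro sum.cong refl) (simp add: marginals_def m_def sum_distrib_left)
  finally show ?thesis
    unfolding sdp_objective_def family_value_def Let_def L_def m_def by (rule arg_cong)
qed

lemma family_value_marginals_restrict:
  assumes "bose_family N \<Psi>" "length outs \<le> N"
  shows "family_value \<rho>E \<rho>S E outs (marginals N (restrict_level N \<Psi>)) = family_value \<rho>E \<rho>S E outs \<Psi>"
proof -
  have "marginals N (restrict_level N \<Psi>) u v = \<Psi> u v"
    if "u \<in> words (length outs)" "v \<in> words (length outs)" for u v
    using that assms bose_family_marginal[OF assms(1), of u "N - length outs" v]
    by (simp add: marginals_def restrict_level_def)
  then show ?thesis by (simp add: family_value_def)
qed

text \<open>The bound matters for words longer than \<open>N\<close>, which
  \<open>bose_family\<close> leaves free and which would spoil compactness. On shorter words it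
  follows from positivity and normalization.\<close>

definition unit_families :: "nat \<Rightarrow> ('h \<times> 'h::finite) list oper set" where
  "unit_families N = {\<Psi>. (\<forall>v w. norm (\<Psi> v w) \<le> 1) \<and> \<Psi> [] [] = 1 \<and> bose_family N \<Psi>}"

section \<open>Compactness of the sets of families\<close>

lemma continuous_on_entry [continuous_intros]:
  "continuous_on S (\<lambda>\<Psi>::'x list oper. \<Psi> v w)"
  by (rule continuous_on_subset[OF continuous_on_product_then_coordinatewise[
        OF continuous_on_product_coordinates] subset_UNIV])

lemma compact_fun_box:
  fixes S :: "'a \<Rightarrow> 'b::topological_space set"
  assumes "\<And>i. compact (S i)" shows "compact {f. \<forall>i. f i \<in> S i}"
proof -
  have "compactin (product_topology (\<lambda>i. euclidean) UNIV) (PiE UNIV S)"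
    using assms by (simp add: compactin_PiE)
  moreover have "PiE UNIV S = {f. \<forall>i. f i \<in> S i}" by auto
  ultimately show ?thesis by (simp add: euclidean_product_topology)
qed

lemma closed_Collect_imp_const:
  assumes "P \<Longrightarrow> closed {y. Q y}" shows "closed {y. P \<longrightarrow> Q y}"
  using assms by (cases P) auto

lemma closed_bose_family: "closed {\<Psi> :: ('h \<times> 'h::finite) list oper. bose_family N \<Psi>}"
proof -
  have "closed {\<Psi> :: ('h \<times> 'h) list oper. psd_on (words n) \<Psi>}" for n
    unfolding psd_on_quad complex_is_Real_iff quad_def
    by (intro closed_Collect_all closed_Collect_conj closed_Collect_eq closed_Collect_le continuous_intros)
  moreover have "closed {\<Psi> :: ('h \<times> 'h) list oper.
      (\<Sum>k\<in>UNIV. \<Psi> ((i, k) # v) ((j, k) # w)) = (if i = j then \<Psi> v w / of_nat CARD('h) else 0)}" for i j v w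
    by (cases "i = j") (auto intro!: closed_Collect_eq continuous_intros)
  moreover have "closed {\<Psi> :: ('h \<times> 'h) list oper. \<Psi> v w = \<Psi> v' w}" for v v' w
    by (intro closed_Collect_eq continuous_intros)
  moreover have "closed {\<Psi> :: ('h \<times> 'h) list oper. \<Psi> v w = 0}" for v w
    by (intro closed_Collect_eq continuous_intros)
  ultimately show ?thesis
    unfolding bose_family_def
    by (intro closed_Collect_conj closed_Collect_all closed_Collect_imp_const)
qed

lemma compact_unit_families: "compact (unit_families N)"
proof -
  have "{\<Psi> :: 'x list oper. \<forall>v w. norm (\<Psi> v w) \<le> 1} = {\<Psi>. \<forall>v. \<Psi> v \<in> {f. \<forall>w. f w \<in> cball 0 1}}"
    by simp
  also have "compact \<dots>"
    by (intro compact_fun_box compact_cball)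
  finally have "compact {\<Psi> :: 'x list oper. \<forall>v w. norm (\<Psi> v w) \<le> 1}" .
  moreover have "closed {\<Psi> :: ('h \<times> 'h::finite) list oper. \<Psi> [] [] = 1 \<and> bose_family N \<Psi>}" for N
    by (intro closed_Collect_conj closed_bose_family closed_Collect_eq continuous_intros)
  ultimately show ?thesis
    unfolding unit_families_def Collect_conj_eq by (intro compact_Int_closed) auto
qed

lemma continuous_on_family_value: "continuous_on S (family_value \<rho>E \<rho>S E outs)"
  unfolding family_value_def by (intro continuous_intros)

lemma unit_families_mono: "M \<le> N \<Longrightarrow> unit_families N \<subseteq> unit_families M"
  unfolding unit_families_def using bose_family_mono by blast

text \<open>\<open>marginals N\<close> and \<open>restrict_level N\<close> need not be inverse to
  each other on words longer than \<open>N\<close>, where a family is arbitrary. Equality of values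
  suffices, and the functional does not read those words.\<close>

lemma sdp_values:
  fixes \<rho>E :: "complex^'e::finite^'e" and \<rho>S :: "complex^'s::finite^'s"
  assumes "length outs \<le> N" "N \<ge> 1"
  shows "{r. \<exists>\<Phi>. sdp_feasible N \<Phi> \<and> r = sdp_objective \<rho>E \<rho>S E outs N \<Phi>}
    = family_value \<rho>E \<rho>S E outs ` unit_families N"
proof (intro equalityI subsetI)
  fix r assume "r \<in> {r. \<exists>\<Phi>. sdp_feasible N \<Phi> \<and> r = sdp_objective \<rho>E \<rho>S E outs N \<Phi>}"
  then obtain \<Phi> where \<Phi>: "sdp_feasible N \<Phi>" "r = sdp_objective \<rho>E \<rho>S E outs N \<Phi>" by blast
  let ?\<Psi> = "marginals N \<Phi>"
  have fam: "bose_family N ?\<Psi>" using \<Phi>(1) assms(2) by (rule bose_family_marginals)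
  have one: "?\<Psi> [] [] = 1" using \<Phi>(1) by (simp add: marginals_def sdp_feasible_def tr_on_def)
  have "norm (?\<Psi> v w) \<le> 1" for v w
  proof (cases "length v \<le> N")
    case True
    then show ?thesis using bose_family_bound[OF fam, of v w] one by simp
  next
    case False
    then show ?thesis using \<Phi>(1) by (simp add: marginals_def sdp_feasible_def opers_def)
  qed
  then have "?\<Psi> \<in> unit_families N" using fam one by (simp add: unit_families_def)
  then show "r \<in> family_value \<rho>E \<rho>S E outs ` unit_families N"
    using \<Phi>(2) by (simp add: sdp_objective_marginals[OF assms(1)])
next
  fix r assume "r \<in> family_value \<rho>E \<rho>S E outs ` unit_families N"
  then obtain \<Psi> where \<Psi>: "bose_family N \<Psi>" "\<Psi> [] [] = 1" "r = family_value \<rho>E \<rho>S E outs \<Psi>"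
    by (auto simp: unit_families_def)
  have "sdp_feasible N (restrict_level N \<Psi>)"
    using \<Psi> assms by (intro sdp_feasible_restrict_level)
  moreover have "r = sdp_objective \<rho>E \<rho>S E outs N (restrict_level N \<Psi>)"
    using assms \<Psi> by (simp add: sdp_objective_marginals family_value_marginals_restrict)
  ultimately show "r \<in> {r. \<exists>\<Phi>. sdp_feasible N \<Phi> \<and> r = sdp_objective \<rho>E \<rho>S E outs N \<Phi>}" by blast
qed

section \<open>The families of unitaries\<close>

lemma choi_entry: "choi \<Lambda> $ (i, k) $ (j, l) = \<Lambda> (ketbra i j) $ k $ l"
proof -
  have "choi \<Lambda> $ (i, k) $ (j, l)
      = (\<Sum>p\<in>UNIV. \<Sum>q\<in>UNIV. if q = j then if p = i then \<Lambda> (ketbra p q) $ k $ l else 0 else 0)"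
    unfolding choi_def tensor_def ketbra_def sum_component vec_lambda_beta
    by (intro sum.cong refl) auto
  then show ?thesis by simp
qed

lemma conj_by_entry:
  "conj_by U \<rho> $ k $ l = (\<Sum>i\<in>UNIV. \<Sum>j\<in>UNIV. \<rho> $ i $ j * U $ k $ i * cnj (U $ l $ j))"
proof -
  have "conj_by U \<rho> $ k $ l = (\<Sum>j\<in>UNIV. \<Sum>i\<in>UNIV. \<rho> $ i $ j * U $ k $ i * cnj (U $ l $ j))"
    by (simp add: conj_by_def matrix_matrix_mult_def dagger_def sum_distrib_left sum_distrib_right mult_ac)
  then show ?thesis by (subst sum.swap)
qed

text \<open>For vectors \<open>\<psi>\<close> this is \<open>(|\<psi>\<rangle>\<langle>\<psi>|)\<^sup>\<otimes>\<^sup>n\<close> at every level \<open>n\<close>.\<close>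

definition pure_family :: "('x \<Rightarrow> complex) \<Rightarrow> 'x list oper" where
  "pure_family \<psi> v w =
     (if length v = length w then prod_list (map \<psi> v) * cnj (prod_list (map \<psi> w)) else 0)"

text \<open>Amplitudes of 1 tensor \<open>U\<close> applied to the normalized maximally entangled
  vector. Labels are pairs (input, output), so the matrix indices appear in reverse.\<close>

definition choi_vec :: "complex^'h^'h \<Rightarrow> 'h \<times> 'h::finite \<Rightarrow> complex" where
  "choi_vec U x = U $ snd x $ fst x / sqrt (of_nat CARD('h))"

lemma sqrt_mult_self_complex: "complex_of_real (sqrt (of_nat n)) * complex_of_real (sqrt (of_nat n)) = of_nat n"
  by (simp flip: of_real_mult)

lemma prod_list_map_mset:
  fixes \<psi> :: "'x \<Rightarrow> complex"
  assumes "mset v' = mset v" shows "prod_list (map \<psi> v') = prod_list (map \<psi> v)"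
proof -
  have "prod_mset (mset (map \<psi> v')) = prod_mset (mset (map \<psi> v))" using assms by simp
  then show ?thesis by (simp only: prod_mset_prod_list)
qed

text \<open>The hypothesis says that the input marginal of the pure state is maximally mixed; for
  \<open>choi_vec U\<close> this is \<open>dagger U ** U = mat 1\<close>.\<close>

lemma bose_family_pure:
  fixes \<psi> :: "'h \<times> 'h::finite \<Rightarrow> complex"
  assumes "\<And>i j. (\<Sum>k\<in>UNIV. \<psi> (i, k) * cnj (\<psi> (j, k))) = (if i = j then 1 / of_nat CARD('h) else 0)"
  shows "bose_family N (pure_family \<psi>)"
proof -
  have "psd_on (words n) (pure_family \<psi>)" for n
  proof -
    have "quad (words n) (pure_family \<psi>) x = of_real ((norm (\<Sum>v\<in>words n. cnj (x v) * prod_list (map \<psi> v)))\<^sup>2)" for x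
    proof -
      have "quad (words n) (pure_family \<psi>) x
        = (\<Sum>v\<in>words n. cnj (x v) * prod_list (map \<psi> v)) * cnj (\<Sum>v\<in>words n. cnj (x v) * prod_list (map \<psi> v))"
        unfolding quad_def cnj_sum sum_product
        by (intro sum.cong refl) (simp add: pure_family_def)
      then show ?thesis by (simp only: complex_norm_square)
    qed
    then show ?thesis by (simp add: psd_on_quad)
  qed
  moreover have "(\<Sum>k\<in>UNIV. pure_family \<psi> ((i, k) # v) ((j, k) # w))
      = (if i = j then pure_family \<psi> v w / of_nat CARD('h) else 0)" for i j v w
  proof -
    have "(\<Sum>k\<in>UNIV. pure_family \<psi> ((i, k) # v) ((j, k) # w))
        = (\<Sum>k\<in>UNIV. \<psi> (i, k) * cnj (\<psi> (j, k)) * pure_family \<psi> v w)"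
      by (intro sum.cong refl) (simp add: pure_family_def)
    also have "\<dots> = (if i = j then pure_family \<psi> v w / of_nat CARD('h) else 0)"
      by (simp add: assms flip: sum_distrib_right)
    finally show ?thesis .
  qed
  moreover have "pure_family \<psi> v' w = pure_family \<psi> v w" if "mset v' = mset v" for v v' w
  proof -
    have "length v' = length v" using that by (metis size_mset)
    then show ?thesis by (simp add: pure_family_def prod_list_map_mset[OF that])
  qed
  moreover have "pure_family \<psi> v w = 0" if "length v \<noteq> length w" for v w
    using that by (simp add: pure_family_def)
  ultimately show ?thesis
    unfolding bose_family_def by blast
qed

lemma unit_families_pure:
  fixes U :: "complex^'h^'h::finite"
  assumes "unitary U"
  shows "pure_family (choi_vec U) \<in> unit_families N"
proof -
  have fam: "bose_family n (pure_family (choi_vec U))" for n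
  proof (rule bose_family_pure)
    fix i j
    have "(\<Sum>k\<in>UNIV. U $ k $ i * cnj (U $ k $ j)) = (dagger U ** U) $ j $ i"
      by (simp add: matrix_matrix_mult_def dagger_def mult.commute)
    also have "\<dots> = (if i = j then 1 else 0)"
      using assms by (simp add: unitary_def mat_def)
    finally have 1: "(\<Sum>k\<in>UNIV. U $ k $ i * cnj (U $ k $ j)) = (if i = j then 1 else 0)" .
    have "(\<Sum>k\<in>UNIV. choi_vec U (i, k) * cnj (choi_vec U (j, k)))
        = (\<Sum>k\<in>UNIV. U $ k $ i * cnj (U $ k $ j)) / of_nat CARD('h)"
      by (simp add: choi_vec_def sum_divide_distrib sqrt_mult_self_complex)
    also have "\<dots> = (if i = j then 1 / of_nat CARD('h) else 0)"
      by (simp add: 1)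
    finally show "(\<Sum>k\<in>UNIV. choi_vec U (i, k) * cnj (choi_vec U (j, k)))
        = (if i = j then 1 / of_nat CARD('h) else 0)" .
  qed
  have one: "pure_family (choi_vec U) [] [] = 1" by (simp add: pure_family_def)
  have "norm (pure_family (choi_vec U) v w) \<le> 1" for v w
    using bose_family_bound[OF fam order.refl, of v w] one by simp
  then show ?thesis using fam one by (simp add: unit_families_def)
qed

text \<open>The part of \<^const>\<open>X_oper\<close> that depends neither on the dimension nor on the initial state.\<close>

definition choi_chain ::
    "('a \<Rightarrow> complex^'h^'h \<Rightarrow> complex^'h^'h) \<Rightarrow> 'a list \<Rightarrow> ('h \<times> 'h::finite) list oper" where
  "choi_chain \<Lambda> outs v w =
     (\<Prod>l<length outs - 1. choi (\<Lambda> (outs ! l)) $ (snd (v ! l), fst (v ! (l + 1)))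
                                  $ (snd (w ! l), fst (w ! (l + 1))))
     * tr_snd (choi (\<Lambda> (outs ! (length outs - 1)))) $ snd (v ! (length outs - 1)) $ snd (w ! (length outs - 1))"

section \<open>Contraction of the Choi chain with a unitary\<close>

lemma choi_chain_single:
  "choi_chain \<Lambda> [a] [x] [y] = (\<Sum>k\<in>UNIV. choi (\<Lambda> a) $ (snd x, k) $ (snd y, k))"
  by (simp add: choi_chain_def tr_snd_def)

lemma choi_chain_Cons:
  assumes "outs \<noteq> []"
  shows "choi_chain \<Lambda> (a # outs) (x # v) (y # w)
    = choi (\<Lambda> a) $ (snd x, fst (v ! 0)) $ (snd y, fst (w ! 0)) * choi_chain \<Lambda> outs v w"
proof -
  obtain n where "length outs = Suc n" using assms by (cases outs) auto
  then show ?thesis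
    by (simp add: choi_chain_def prod.lessThan_Suc_shift del: prod.lessThan_Suc)
qed

text \<open>Contracting the input labels of \<open>x\<close> and \<open>y\<close> with
  \<open>\<rho>\<close> produces \<open>conj_by U \<rho>\<close>; contracting their output labels
  with the Choi matrix then applies \<open>\<Lambda>\<close>. The assumption is linearity, written
  on matrix units.\<close>

lemma link_product_step:
  assumes "\<And>\<rho> k l. \<Lambda> \<rho> $ k $ l = (\<Sum>p\<in>UNIV. \<Sum>q\<in>UNIV. \<rho> $ p $ q * \<Lambda> (ketbra p q) $ k $ l)"
  shows "(\<Sum>x\<in>UNIV. \<Sum>y\<in>UNIV. \<rho> $ fst x $ fst y * choi \<Lambda> $ (snd x, k) $ (snd y, l)
      * (U $ snd x $ fst x * cnj (U $ snd y $ fst y))) = \<Lambda> (conj_by U \<rho>) $ k $ l"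
proof -
  let ?f = "\<lambda>i p j q. \<rho> $ i $ j * \<Lambda> (ketbra p q) $ k $ l * (U $ p $ i * cnj (U $ q $ j))"
  have "(\<Sum>x\<in>UNIV. \<Sum>y\<in>UNIV. \<rho> $ fst x $ fst y * choi \<Lambda> $ (snd x, k) $ (snd y, l)
      * (U $ snd x $ fst x * cnj (U $ snd y $ fst y)))
    = (\<Sum>i\<in>UNIV. \<Sum>p\<in>UNIV. \<Sum>j\<in>UNIV. \<Sum>q\<in>UNIV. ?f i p j q)"
    by (simp add: sum_pair choi_entry)
  also have "\<dots> = (\<Sum>p\<in>UNIV. \<Sum>i\<in>UNIV. \<Sum>j\<in>UNIV. \<Sum>q\<in>UNIV. ?f i p j q)"
    by (rule sum.swap)
  also have "\<dots> = (\<Sum>p\<in>UNIV. \<Sum>i\<in>UNIV. \<Sum>q\<in>UNIV. \<Sum>j\<in>UNIV. ?f i p j q)"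
    by (intro sum.cong refl sum.swap)
  also have "\<dots> = (\<Sum>p\<in>UNIV. \<Sum>q\<in>UNIV. \<Sum>i\<in>UNIV. \<Sum>j\<in>UNIV. ?f i p j q)"
    by (intro sum.cong refl sum.swap)
  also have "\<dots> = (\<Sum>p\<in>UNIV. \<Sum>q\<in>UNIV. conj_by U \<rho> $ p $ q * \<Lambda> (ketbra p q) $ k $ l)"
    by (intro sum.cong refl) (simp add: conj_by_entry sum_distrib_left sum_distrib_right mult_ac)
  also have "\<dots> = \<Lambda> (conj_by U \<rho>) $ k $ l"
    by (rule assms[symmetric])
  finally show ?thesis .
qed

text \<open>The first copy is absorbed into the state, which therefore has to be arbitrary in the
  induction. The traced output of the last Choi matrix becomes the trace of the final state.\<close>

lemma link_product_chain:
  fixes \<Lambda> :: "'a \<Rightarrow> complex^'h^'h \<Rightarrow> complex^'h^'h::finite"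
  assumes lin: "\<And>a \<rho> k l. \<Lambda> a \<rho> $ k $ l = (\<Sum>p\<in>UNIV. \<Sum>q\<in>UNIV. \<rho> $ p $ q * \<Lambda> a (ketbra p q) $ k $ l)"
  assumes "outs \<noteq> []"
  shows "(\<Sum>v\<in>words (length outs). \<Sum>w\<in>words (length outs).
      \<rho> $ fst (v ! 0) $ fst (w ! 0) * choi_chain \<Lambda> outs v w
      * (prod_list (map (\<lambda>x. U $ snd x $ fst x) v) * cnj (prod_list (map (\<lambda>x. U $ snd x $ fst x) w))))
    = trace (fold (\<lambda>a \<rho>. \<Lambda> a (conj_by U \<rho>)) outs \<rho>)"
  using assms(2)
proof (induction outs arbitrary: \<rho> rule: list_nonempty_induct)
  case (single a)
  have "(\<Sum>x\<in>UNIV. \<Sum>y\<in>UNIV. \<rho> $ fst x $ fst y * choi_chain \<Lambda> [a] [x] [y]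
      * (U $ snd x $ fst x * cnj (U $ snd y $ fst y)))
    = (\<Sum>x\<in>UNIV. \<Sum>y\<in>UNIV. \<Sum>k\<in>UNIV. \<rho> $ fst x $ fst y * choi (\<Lambda> a) $ (snd x, k) $ (snd y, k)
      * (U $ snd x $ fst x * cnj (U $ snd y $ fst y)))"
    by (simp add: choi_chain_single sum_distrib_left sum_distrib_right)
  also have "\<dots> = (\<Sum>x\<in>UNIV. \<Sum>k\<in>UNIV. \<Sum>y\<in>UNIV. \<rho> $ fst x $ fst y * choi (\<Lambda> a) $ (snd x, k) $ (snd y, k)
      * (U $ snd x $ fst x * cnj (U $ snd y $ fst y)))"
    by (intro sum.cong refl sum.swap)
  also have "\<dots> = (\<Sum>k\<in>UNIV. \<Sum>x\<in>UNIV. \<Sum>y\<in>UNIV. \<rho> $ fst x $ fst y * choi (\<Lambda> a) $ (snd x, k) $ (snd y, k)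
      * (U $ snd x $ fst x * cnj (U $ snd y $ fst y)))"
    by (rule sum.swap)
  also have "\<dots> = trace (\<Lambda> a (conj_by U \<rho>))"
    by (simp only: link_product_step[OF lin] trace_def)
  finally show ?case by (simp add: sum_words_Suc)
next
  case (cons a outs)
  let ?L = "length outs"
  let ?U = "\<lambda>x. U $ snd x $ fst x"
  let ?P = "\<lambda>v w. prod_list (map ?U v) * cnj (prod_list (map ?U w))"
  let ?f = "\<lambda>x y v w. \<rho> $ fst x $ fst y * choi (\<Lambda> a) $ (snd x, fst (v ! 0)) $ (snd y, fst (w ! 0))
      * (?U x * cnj (?U y)) * (choi_chain \<Lambda> outs v w * ?P v w)"
  have "(\<Sum>v\<in>words (length (a # outs)). \<Sum>w\<in>words (length (a # outs)).
      \<rho> $ fst (v ! 0) $ fst (w ! 0) * choi_chain \<Lambda> (a # outs) v w * ?P v w)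
    = (\<Sum>x\<in>UNIV. \<Sum>v\<in>words ?L. \<Sum>y\<in>UNIV. \<Sum>w\<in>words ?L. ?f x y v w)"
    by (simp add: sum_words_Suc choi_chain_Cons[OF cons(1)] mult_ac)
  also have "\<dots> = (\<Sum>v\<in>words ?L. \<Sum>w\<in>words ?L. \<Sum>x\<in>UNIV. \<Sum>y\<in>UNIV. ?f x y v w)"
    by (rule sum_swap4[symmetric])
  also have "\<dots> = (\<Sum>v\<in>words ?L. \<Sum>w\<in>words ?L.
      \<Lambda> a (conj_by U \<rho>) $ fst (v ! 0) $ fst (w ! 0) * (choi_chain \<Lambda> outs v w * ?P v w))"
    by (intro sum.cong refl) (simp only: link_product_step[OF lin] flip: sum_distrib_right)
  also have "\<dots> = trace (fold (\<lambda>a \<rho>. \<Lambda> a (conj_by U \<rho>)) outs (\<Lambda> a (conj_by U \<rho>)))"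
    using cons.IH by (simp only: mult.assoc)
  finally show ?case by simp
qed

lemma meas_prep_linear:
  fixes \<rho> :: "complex^('e::finite \<times> 's::finite)^('e \<times> 's)"
  shows "meas_prep \<rho>S E a \<rho> $ k $ l
    = (\<Sum>p\<in>UNIV. \<Sum>q\<in>UNIV. \<rho> $ p $ q * meas_prep \<rho>S E a (ketbra p q) $ k $ l)"
proof -
  define T :: "complex^('e \<times> 's)^('e \<times> 's)" where "T = mat 1 \<otimes>\<^sub>m E a"
  define c where "c = \<rho>S $ snd k $ snd l"
  let ?f = "fst k" and ?g = "fst l"
  have mp: "meas_prep \<rho>S E a A $ k $ l = (\<Sum>t\<in>UNIV. \<Sum>r\<in>UNIV. A $ (?f, t) $ r * T $ r $ (?g, t)) * c" for A
    by (simp add: meas_prep_def tensor_def tr_snd_def matrix_matrix_mult_def T_def c_def)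
  have kb: "meas_prep \<rho>S E a (ketbra p q) $ k $ l = (\<Sum>t\<in>UNIV. if p = (?f, t) then T $ q $ (?g, t) * c else 0)" for p q
  proof -
    have "(\<Sum>r\<in>UNIV. ketbra p q $ (?f, t) $ r * T $ r $ (?g, t))
        = (\<Sum>r\<in>UNIV. if r = q then if p = (?f, t) then T $ q $ (?g, t) else 0 else 0)" for t
      by (intro sum.cong refl) (auto simp: ketbra_def)
    then have *: "(\<Sum>r\<in>UNIV. ketbra p q $ (?f, t) $ r * T $ r $ (?g, t))
        = (if p = (?f, t) then T $ q $ (?g, t) else 0)" for t
      by simp
    then show ?thesis unfolding mp * by (subst sum_distrib_right) (intro sum.cong refl, simp)
  qed
  have "(\<Sum>p\<in>UNIV. \<Sum>q\<in>UNIV. \<rho> $ p $ q * meas_prep \<rho>S E a (ketbra p q) $ k $ l)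
      = (\<Sum>p\<in>UNIV. \<Sum>q\<in>UNIV. \<Sum>t\<in>UNIV. if p = (?f, t) then \<rho> $ p $ q * T $ q $ (?g, t) * c else 0)"
    unfolding kb sum_distrib_left by (intro sum.cong refl) auto
  also have "\<dots> = (\<Sum>p\<in>UNIV. \<Sum>t\<in>UNIV. \<Sum>q\<in>UNIV. if p = (?f, t) then \<rho> $ p $ q * T $ q $ (?g, t) * c else 0)"
    by (intro sum.cong refl sum.swap)
  also have "\<dots> = (\<Sum>t\<in>UNIV. \<Sum>p\<in>UNIV. \<Sum>q\<in>UNIV. if p = (?f, t) then \<rho> $ p $ q * T $ q $ (?g, t) * c else 0)"
    by (rule sum.swap)
  also have "\<dots> = (\<Sum>t\<in>UNIV. \<Sum>q\<in>UNIV. \<Sum>p\<in>UNIV. if p = (?f, t) then \<rho> $ p $ q * T $ q $ (?g, t) * c else 0)"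
    by (intro sum.cong refl sum.swap)
  also have "\<dots> = meas_prep \<rho>S E a \<rho> $ k $ l"
    by (simp add: mp sum_distrib_right)
  finally show ?thesis by (rule sym)
qed

lemma family_value_pure:
  fixes \<rho>E :: "complex^'e::finite^'e" and \<rho>S :: "complex^'s::finite^'s"
  assumes "outs \<noteq> []"
  shows "family_value \<rho>E \<rho>S E outs (pure_family (choi_vec U)) = outcome_prob \<rho>E \<rho>S E outs U"
proof -
  define L where "L = length outs"
  let ?U = "\<lambda>x. U $ snd x $ fst x"
  let ?d = "of_nat (CARD('e) * CARD('s)) :: complex"
  let ?chain = "choi_chain (meas_prep \<rho>S E) outs"
  have "?d \<noteq> 0" by simp
  have choi: "prod_list (map (choi_vec U) v) = prod_list (map ?U v) / of_real (sqrt (of_nat (CARD('e) * CARD('s)))) ^ length v" for v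
    by (induction v) (simp_all add: choi_vec_def)
  \<comment> \<open>The power of the dimension in \<open>X_oper\<close> cancels the square roots
    that normalize the \<open>L\<close> row and \<open>L\<close> column amplitudes.\<close>
  have sq: "complex_of_real (sqrt (of_nat (CARD('e) * CARD('s)))) ^ L * complex_of_real (sqrt (of_nat (CARD('e) * CARD('s)))) ^ L = ?d ^ L"
    unfolding power_mult_distrib[symmetric] sqrt_mult_self_complex ..
  have "X_oper \<rho>E \<rho>S E outs v w * pure_family (choi_vec U) v w
      = (\<rho>E \<otimes>\<^sub>m \<rho>S) $ fst (v ! 0) $ fst (w ! 0) * ?chain v w * (prod_list (map ?U v) * cnj (prod_list (map ?U w)))"
    if vw: "v \<in> words L" "w \<in> words L" for v w
  proof -
    have "X_oper \<rho>E \<rho>S E outs v w = ?d ^ L * ((\<rho>E \<otimes>\<^sub>m \<rho>S) $ fst (v ! 0) $ fst (w ! 0) * ?chain v w)"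
      using vw by (simp add: X_oper_def choi_chain_def L_def Let_def mult.assoc)
    moreover have "pure_family (choi_vec U) v w = prod_list (map ?U v) * cnj (prod_list (map ?U w)) / ?d ^ L"
      using vw unfolding sq[symmetric] by (simp add: pure_family_def choi)
    ultimately show ?thesis using \<open>?d \<noteq> 0\<close> by simp
  qed
  then have "(\<Sum>v\<in>words L. \<Sum>w\<in>words L. X_oper \<rho>E \<rho>S E outs v w * pure_family (choi_vec U) v w)
    = (\<Sum>v\<in>words L. \<Sum>w\<in>words L. (\<rho>E \<otimes>\<^sub>m \<rho>S) $ fst (v ! 0) $ fst (w ! 0) * ?chain v w
        * (prod_list (map ?U v) * cnj (prod_list (map ?U w))))"
    by (intro sum.cong refl)
  also have "\<dots> = trace (fold (\<lambda>a \<rho>. meas_prep \<rho>S E a (conj_by U \<rho>)) outs (\<rho>E \<otimes>\<^sub>m \<rho>S))"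
    unfolding L_def by (intro link_product_chain meas_prep_linear assms)
  finally show ?thesis
    unfolding family_value_def outcome_prob_def L_def by (rule arg_cong)
qed

section \<open>Extremal infinite families\<close>

definition limit_families :: "('h \<times> 'h::finite) list oper set" where
  "limit_families = (\<Inter>N. unit_families N)"

lemma limit_families_iff:
  "\<Psi> \<in> limit_families \<longleftrightarrow> \<Psi> [] [] = 1 \<and> (\<forall>N. bose_family N \<Psi>)"
proof
  assume \<Psi>: "\<Psi> [] [] = 1 \<and> (\<forall>N. bose_family N \<Psi>)"
  have "norm (\<Psi> v w) \<le> 1" for v w
    using bose_family_bound[of "length v" \<Psi> v w] \<Psi> by simp
  with \<Psi> show "\<Psi> \<in> limit_families" by (simp add: limit_families_def unit_families_def)
qed (simp add: limit_families_def unit_families_def)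

lemma compact_limit_families: "compact (limit_families :: ('h \<times> 'h::finite) list oper set)"
proof -
  have "limit_families = (unit_families 0 :: ('h \<times> 'h) list oper set) \<inter> (\<Inter>N. {\<Psi>. bose_family N \<Psi>})"
    by (auto simp: limit_families_def unit_families_def)
  also have "compact \<dots>"
    by (intro compact_Int_closed compact_unit_families closed_INT ballI closed_bose_family)
  finally show ?thesis .
qed

text \<open>Pieces of a measured family are not normalized; the entry at the empty words carries
  their weight.\<close>

abbreviation limit_cone :: "('h \<times> 'h::finite) list oper \<Rightarrow> bool" where
  "limit_cone \<Psi> \<equiv> \<forall>N. bose_family N \<Psi>"

lemma limit_cone_mass:
  assumes "limit_cone \<Psi>"
  shows "Re (\<Psi> [] []) \<ge> 0" "\<Psi> [] [] = of_real (Re (\<Psi> [] []))"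
  using psd_on_diag[OF bose_family_psd[OF assms[rule_format, of 0], of 0], of "[]"]
  by (auto simp: complex_eq_iff)

lemma limit_cone_zero:
  assumes "limit_cone \<Psi>" "\<Psi> [] [] = 0" shows "\<Psi> v w = 0"
  using bose_family_bound[OF assms(1)[rule_format], of v "length v" w] assms(2) by simp

lemma limit_cone_normalize:
  assumes "limit_cone \<Psi>" "\<Psi> [] [] = of_real a" "a > 0"
  shows "(\<lambda>v w. of_real (1 / a) * \<Psi> v w) \<in> limit_families"
  unfolding limit_families_iff
  using assms by (auto intro!: bose_family_scale simp del: of_real_divide) (simp add: field_simps)

text \<open>A weighted parallelogram identity: the last term is the exact gain of strict
  convexity.\<close>

lemma norm_convex_combination:
  fixes p q :: complex
  assumes "a + b = 1"
  shows "(norm (of_real a * p + of_real b * q))\<^sup>2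
    = a * (norm p)\<^sup>2 + b * (norm q)\<^sup>2 - a * b * (norm (p - q))\<^sup>2"
proof -
  have b: "b = 1 - a" using assms by simp
  show ?thesis unfolding cmod_power2 b by (simp add: power2_eq_square algebra_simps)
qed

text \<open>The squared Hilbert-Schmidt norm at level \<open>L\<close>, which for a family is the
  purity of its marginal on \<open>L\<close> copies.\<close>

definition level_weight :: "nat \<Rightarrow> 'x list oper \<Rightarrow> real" where
  "level_weight L \<Psi> = (\<Sum>v\<in>words L. \<Sum>w\<in>words L. (norm (\<Psi> v w))\<^sup>2)"

lemma continuous_on_level_weight: "continuous_on S (level_weight L)"
  unfolding level_weight_def by (intro continuous_intros)

lemma family_value_combination:
  fixes \<rho>E :: "complex^'e::finite^'e" and \<rho>S :: "complex^'s::finite^'s"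
  shows "family_value \<rho>E \<rho>S E outs (\<lambda>v w. of_real a * A v w + of_real b * B v w)
    = a * family_value \<rho>E \<rho>S E outs A + b * family_value \<rho>E \<rho>S E outs B"
proof -
  have "(\<Sum>v\<in>W. \<Sum>w\<in>W. X v w * (of_real a * A v w + of_real b * B v w))
      = of_real a * (\<Sum>v\<in>W. \<Sum>w\<in>W. X v w * A v w) + of_real b * (\<Sum>v\<in>W. \<Sum>w\<in>W. X v w * B v w)"
    for W and X :: "(('e \<times> 's) \<times> ('e \<times> 's)) list oper"
    by (simp add: sum_distrib_left sum.distrib algebra_simps)
  then show ?thesis by (simp add: family_value_def)
qed

context
  fixes f :: "('h \<times> 'h::finite) list oper \<Rightarrow> real" and L :: nat and \<Psi> :: "('h \<times> 'h) list oper"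
  assumes f_lin: "\<And>a b A B. f (\<lambda>v w. of_real a * A v w + of_real b * B v w) = a * f A + b * f B"
    and \<Psi>: "\<Psi> \<in> limit_families"
    and f_max: "\<And>\<Psi>'. \<Psi>' \<in> limit_families \<Longrightarrow> f \<Psi>' \<le> f \<Psi>"
    and weight_max: "\<And>\<Psi>'. \<Psi>' \<in> limit_families \<Longrightarrow> f \<Psi>' = f \<Psi> \<Longrightarrow> level_weight L \<Psi>' \<le> level_weight L \<Psi>"
begin

text \<open>Strict convexity of \<^const>\<open>level_weight\<close> on level \<open>L\<close> is what makes \<open>\<Psi>\<close> extremal there.\<close>

lemma extremal_decomposition:
  assumes A: "limit_cone A" and B: "limit_cone B" and AB: "\<And>v w. \<Psi> v w = A v w + B v w"
    and vw: "v \<in> words L" "w \<in> words L"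
  shows "A v w = A [] [] * \<Psi> v w"
proof -
  define a b where "a = Re (A [] [])" and "b = Re (B [] [])"
  have a: "A [] [] = of_real a" "a \<ge> 0" and b: "B [] [] = of_real b" "b \<ge> 0"
    using limit_cone_mass[OF A] limit_cone_mass[OF B] by (simp_all add: a_def b_def)
  have "of_real (a + b) = (1 :: complex)"
    using \<Psi> AB[of "[]" "[]"] a b by (simp add: limit_families_iff)
  then have ab: "a + b = 1" using of_real_eq_1_iff by blast
  consider "a = 0" | "b = 0" | "a > 0" "b > 0" using a b by linarith
  then show ?thesis
  proof cases
    case 1
    then show ?thesis using limit_cone_zero[OF A] a by simp
  next
    case 2
    then show ?thesis using limit_cone_zero[OF B] a b ab AB[of v w] by simp
  next
    case 3
    define A' B' where "A' = (\<lambda>v w. of_real (1 / a) * A v w)" and "B' = (\<lambda>v w. of_real (1 / b) * B v w)"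
    have A': "A' \<in> limit_families" and B': "B' \<in> limit_families"
      unfolding A'_def B'_def using A B a b 3 by (blast intro: limit_cone_normalize)+
    have comb: "\<Psi> = (\<lambda>v w. of_real a * A' v w + of_real b * B' v w)"
      using 3 by (intro ext) (simp add: AB A'_def B'_def)
    \<comment> \<open>Both pieces have to maximize \<open>f\<close> as well, since
      \<open>weight_max\<close> compares weights among maximizers only.\<close>
    have "f \<Psi> = a * f A' + b * f B'"
      by (subst comb) (rule f_lin)
    moreover have "f A' \<le> f \<Psi>" "f B' \<le> f \<Psi>"
      using A' B' f_max by auto
    moreover have "a * f \<Psi> + b * f \<Psi> = f \<Psi>"
      using ab by (metis distrib_right mult_1)
    moreover have "a * f A' \<le> a * f \<Psi>" "b * f B' \<le> b * f \<Psi>"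
      using 3 calculation by auto
    ultimately have "a * f A' = a * f \<Psi>" "b * f B' = b * f \<Psi>" by linarith+
    then have "f A' = f \<Psi>" "f B' = f \<Psi>" using 3 by auto
    then have wA: "level_weight L A' \<le> level_weight L \<Psi>" and wB: "level_weight L B' \<le> level_weight L \<Psi>"
      using weight_max A' B' by auto
    \<comment> \<open>The squared distance of the two pieces at level \<open>L\<close>; a positive
      value would make \<open>\<Psi>\<close> lighter than the average of its pieces, against
      maximality.\<close>
    define D where "D = (\<Sum>v\<in>words L. \<Sum>w\<in>words L. (norm (A' v w - B' v w))\<^sup>2)"
    have "level_weight L \<Psi> = a * level_weight L A' + b * level_weight L B' - a * b * D"
      by (subst comb, unfold level_weight_def D_def)
        (simp only: norm_convex_combination[OF ab] sum.distrib sum_subtractf sum_distrib_left)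
    also have "\<dots> \<le> a * level_weight L \<Psi> + b * level_weight L \<Psi> - a * b * D"
      using wA wB 3 by (intro diff_right_mono add_mono mult_left_mono) auto
    also have "\<dots> = level_weight L \<Psi> - a * b * D"
      using ab by (metis distrib_right mult_1)
    finally have "a * b * D \<le> 0" by simp
    then have "D \<le> 0" using 3 by (simp add: mult_le_0_iff)
    moreover have "(norm (A' v w - B' v w))\<^sup>2 \<le> D"
    proof -
      have "(norm (A' v w - B' v w))\<^sup>2 \<le> (\<Sum>w\<in>words L. (norm (A' v w - B' v w))\<^sup>2)"
        using vw by (intro member_le_sum) auto
      also have "\<dots> \<le> D"
        unfolding D_def using vw
        by (intro member_le_sum[where f = "\<lambda>v. \<Sum>w\<in>words L. (norm (A' v w - B' v w))\<^sup>2"]) (auto intro!: sum_nonneg)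
      finally show ?thesis .
    qed
    ultimately have "(norm (A' v w - B' v w))\<^sup>2 \<le> 0" by linarith
    then have eq: "A' v w = B' v w" by simp
    have "\<Psi> v w = of_real (a + b) * A' v w"
      unfolding comb by (simp add: eq algebra_simps)
    then show ?thesis using 3 by (simp add: ab A'_def a(1))
  qed
qed

text \<open>Sums of cone elements stay in the cone, so one piece against the sum of all others is a
  decomposition in two.\<close>

lemma extremal_sum:
  assumes "finite I" "\<And>k. k \<in> I \<Longrightarrow> limit_cone (A k)" "\<And>v w. \<Psi> v w = (\<Sum>k\<in>I. A k v w)"
    and "k \<in> I" "v \<in> words L" "w \<in> words L"
  shows "A k v w = A k [] [] * \<Psi> v w"
proof (rule extremal_decomposition)
  show "limit_cone (\<lambda>v w. \<Sum>j\<in>I - {k}. A j v w)"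
    using assms(2) by (intro allI bose_family_sum) auto
  show "\<Psi> v w = A k v w + (\<Sum>j\<in>I - {k}. A j v w)" for v w
    using assms by (simp add: sum.remove)
qed (use assms in auto)

text \<open>The vectors \<open>e\<^sub>x + s e\<^sub>y\<close> with \<open>s\<close> a fourth root of unity give rank one effects that
  resolve a multiple of the identity and, by polarization, span all operators.\<close>

lemma extremal_product:
  assumes "v \<in> words L" "w \<in> words L"
  shows "\<Psi> (x # v) (y # w) = \<Psi> [x] [y] * \<Psi> v w"
proof -
  define S where "S = {1, -1, \<i>, -\<i>}"
  have S: "(\<Sum>s\<in>S. h s) = h 1 + h (-1) + h \<i> + h (-\<i>)" for h :: "complex \<Rightarrow> complex"
    by (simp add: S_def complex_eq_iff)
  have finS: "finite S" by (simp add: S_def)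
  define g where "g x y s = (\<lambda>z. (if z = x then 1 else 0) + (if z = y then s else 0))"
    for x y :: "'h \<times> 'h" and s :: complex
  have cond: "condition (g x y s) \<Psi> v w = \<Psi> (x # v) (x # w) + s * \<Psi> (x # v) (y # w)
      + cnj s * \<Psi> (y # v) (x # w) + cnj s * s * \<Psi> (y # v) (y # w)" for x y s v w
  proof -
    have "condition (g x y s) \<Psi> v w = (\<Sum>p\<in>UNIV. \<Sum>q\<in>UNIV.
        (if q = x then if p = x then \<Psi> (p # v) (q # w) else 0 else 0)
      + (if q = y then if p = x then \<Psi> (p # v) (q # w) * s else 0 else 0)
      + (if q = x then if p = y then cnj s * \<Psi> (p # v) (q # w) else 0 else 0)
      + (if q = y then if p = y then cnj s * \<Psi> (p # v) (q # w) * s else 0 else 0))"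
      unfolding condition_def g_def by (intro sum.cong refl) (auto simp: algebra_simps)
    then show ?thesis by (simp add: sum.distrib mult_ac)
  qed
  \<comment> \<open>For each pair of labels the four roots leave 4 times each of two diagonal terms;
    summing over both labels gives 8 times the dimension of a copy times the marginal.\<close>
  define c where "c = 1 / (8 * real CARD('h \<times> 'h))"
  define A where "A = (\<lambda>(x, y, s) v w. of_real c * condition (g x y s) \<Psi> v w)"
  have fam: "limit_cone \<Psi>" using \<Psi> by (simp add: limit_families_iff)
  have cone: "limit_cone (A k)" for k
    unfolding A_def using fam
    by (auto simp: c_def case_prod_unfold simp del: of_real_divide intro!: bose_family_scale bose_family_condition)
  have decomp: "\<Psi> v w = (\<Sum>k\<in>UNIV \<times> UNIV \<times> S. A k v w)" for v w
  proof -
    have "(\<Sum>k\<in>UNIV \<times> UNIV \<times> S. A k v w)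
        = (\<Sum>x\<in>UNIV. \<Sum>y\<in>UNIV. \<Sum>s\<in>S. of_real c * condition (g x y s) \<Psi> v w)"
      by (simp only: sum.cartesian_product' A_def prod.case)
    also have "\<dots> = (\<Sum>x\<in>UNIV. \<Sum>y\<in>UNIV. of_real c * (4 * \<Psi> (x # v) (x # w) + 4 * \<Psi> (y # v) (y # w)))"
      by (intro sum.cong refl) (simp only: S cond, simp add: algebra_simps)
    also have "\<dots> = of_real c * (8 * of_nat CARD('h \<times> 'h) * (\<Sum>x\<in>UNIV. \<Psi> (x # v) (x # w)))"
      by (simp add: sum.distrib sum_distrib_left algebra_simps)
    also have "(\<Sum>x\<in>UNIV. \<Psi> (x # v) (x # w)) = \<Psi> v w"
      using fam by (intro bose_family_tr_A1[of "Suc (length v)"]) auto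
    also have "of_real c * (8 * of_nat CARD('h \<times> 'h) * \<Psi> v w) = \<Psi> v w"
      by (simp add: c_def)
    finally show ?thesis by (rule sym)
  qed
  have c0: "complex_of_real c \<noteq> 0" by (simp add: c_def)
  have factor: "condition (g x y s) \<Psi> v w = condition (g x y s) \<Psi> [] [] * \<Psi> v w" if "s \<in> S" for s
    using extremal_sum[of "UNIV \<times> UNIV \<times> S" A "(x, y, s)" v w] finS cone decomp that assms c0
    by (simp add: A_def)
  \<comment> \<open>Weighting by \<open>cnj s\<close> and summing over the roots keeps only the term
    with factor \<open>s\<close>; the roots 1 and -1 alone would not separate it from the term with
    factor \<open>cnj s\<close>.\<close>
  have polar: "4 * \<Psi> (x # v) (y # w) = (\<Sum>s\<in>S. cnj s * condition (g x y s) \<Psi> v w)" for v w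
    unfolding cond S by (simp add: algebra_simps)
  have "4 * \<Psi> (x # v) (y # w) = (\<Sum>s\<in>S. cnj s * (condition (g x y s) \<Psi> [] [] * \<Psi> v w))"
    unfolding polar by (intro sum.cong refl) (simp add: factor)
  also have "\<dots> = (\<Sum>s\<in>S. cnj s * condition (g x y s) \<Psi> [] []) * \<Psi> v w"
    by (simp add: sum_distrib_right mult.assoc)
  also have "\<dots> = 4 * \<Psi> [x] [y] * \<Psi> v w"
    by (simp flip: polar)
  finally show ?thesis by simp
qed

text \<open>Shorter words are filled up to length \<open>L\<close> and the filling is traced out
  again; the induction that yields the full product passes through all these lengths.\<close>

lemma extremal_product_le:
  assumes "length v \<le> L" "length w = length v"
  shows "\<Psi> (x # v) (y # w) = \<Psi> [x] [y] * \<Psi> v w"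
proof -
  have fam: "limit_cone \<Psi>" using \<Psi> by (simp add: limit_families_iff)
  let ?T = "words (L - length v) :: ('h \<times> 'h) list set"
  have "\<Psi> (x # v) (y # w) = (\<Sum>t\<in>?T. \<Psi> ((x # v) @ t) ((y # w) @ t))"
    using assms by (intro bose_family_marginal[OF fam[rule_format, of "Suc L"], symmetric]) auto
  also have "\<dots> = (\<Sum>t\<in>?T. \<Psi> [x] [y] * \<Psi> (v @ t) (w @ t))"
    using assms by (intro sum.cong refl) (simp add: extremal_product)
  also have "\<dots> = \<Psi> [x] [y] * \<Psi> v w"
    using assms by (simp add: bose_family_marginal[OF fam[rule_format, of L]] flip: sum_distrib_left)
  finally show ?thesis .
qed

lemma extremal_unitary:
  assumes "L \<ge> 1"
  obtains U where "unitary U" "\<And>v w. v \<in> words L \<Longrightarrow> w \<in> words L \<Longrightarrow> \<Psi> v w = pure_family (choi_vec U) v w"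
proof -
  have fam: "limit_cone \<Psi>" and one: "\<Psi> [] [] = 1" using \<Psi> by (simp_all add: limit_families_iff)
  define R where "R x y = \<Psi> [x] [y]" for x y
  have herm: "R y x = cnj (R x y)" for x y
    unfolding R_def using fam by (intro bose_family_hermitian[of 1]) auto
  \<comment> \<open>Exchanging rows without columns makes every two by two minor of \<open>R\<close>
    vanish.\<close>
  have swap: "R x y * R x' y' = R x' y * R x y'" for x x' y y'
  proof -
    have "R x y * R x' y' = \<Psi> [x, x'] [y, y']"
      using assms extremal_product_le[of "[x']" "[y']" x y] by (simp add: R_def)
    also have "\<dots> = \<Psi> [x', x] [y, y']"
      using fam by (intro bose_family_perm1[of 2]) auto
    also have "\<dots> = R x' y * R x y'"
      using assms extremal_product_le[of "[x]" "[y']" x' y] by (simp add: R_def)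
    finally show ?thesis .
  qed
  have "(\<Sum>x\<in>UNIV. R x x) = 1"
    using bose_family_tr_A1[OF fam[rule_format, of 1], of "[]" "[]"] one by (simp add: R_def)
  then obtain x0 where x0: "R x0 x0 \<noteq> 0"
    by (metis sum.neutral zero_neq_one)
  define r where "r = Re (R x0 x0)"
  have "psd_on (words 1) \<Psi>"
    using fam by (intro bose_family_psd[of 1]) auto
  from psd_on_diag[OF this, of "[x0]"] have r: "R x0 x0 = of_real r" "r > 0"
    using x0 by (auto simp: R_def r_def complex_eq_iff)
  \<comment> \<open>A positive matrix of rank one is recovered from any column with nonzero diagonal
    entry, divided by the root of that entry.\<close>
  define \<psi> where "\<psi> x = R x x0 / of_real (sqrt r)" for x
  have R: "R x y = \<psi> x * cnj (\<psi> y)" for x y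
  proof -
    have "R x y * of_real r = R x x0 * cnj (R y x0)"
      using swap[of x y x0 x0] herm[of x0 y] r(1) by (simp add: mult.commute)
    moreover have "complex_of_real (sqrt r) * complex_of_real (sqrt r) = of_real r"
      using r(2) by (simp flip: of_real_mult)
    ultimately show ?thesis using r(2) by (simp add: \<psi>_def field_simps)
  qed
  have pure: "\<Psi> v w = pure_family \<psi> v w" if "length v \<le> L" "length w = length v" for v w
    using that
  proof (induction v arbitrary: w)
    case Nil
    then show ?case by (simp add: one pure_family_def)
  next
    case (Cons x v)
    then obtain y w' where w: "w = y # w'" by (cases w) auto
    show ?case
      using Cons.prems Cons.IH[of w'] extremal_product_le[of v w' x y] R[of x y]
      by (simp add: w pure_family_def R_def)
  qed
  define U :: "complex^'h^'h" where "U = (\<chi> k i. of_real (sqrt (of_nat CARD('h))) * \<psi> (i, k))"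
  have "dagger U ** U = mat 1"
  proof -
    have "(dagger U ** U) $ i $ j = mat 1 $ i $ j" for i j
    proof -
      have "(dagger U ** U) $ i $ j = of_nat CARD('h) * (\<Sum>k\<in>UNIV. \<psi> (j, k) * cnj (\<psi> (i, k)))"
        by (simp add: matrix_matrix_mult_def dagger_def U_def sum_distrib_left
            mult_ac flip: sqrt_mult_self_complex[of "CARD('h)"])
      also have "(\<Sum>k\<in>UNIV. \<psi> (j, k) * cnj (\<psi> (i, k))) = (if j = i then 1 / of_nat CARD('h) else 0)"
        using bose_family_constraint[OF fam[rule_format, of 1], of "[]" j i "[]"] one
        by (simp add: R flip: R_def)
      finally show ?thesis by (simp add: mat_def)
    qed
    then show ?thesis by (simp add: vec_eq_iff)
  qed
  then have "unitary U"
    by (simp add: unitary_def matrix_left_right_inverse[of "dagger U" U])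
  moreover have "choi_vec U = \<psi>"
    by (simp add: choi_vec_def U_def fun_eq_iff)
  ultimately show thesis using that[of U] pure by simp
qed

end

lemma family_value_cong:
  assumes "\<And>v w. v \<in> words (length outs) \<Longrightarrow> w \<in> words (length outs) \<Longrightarrow> \<Psi> v w = \<Psi>' v w"
  shows "family_value \<rho>E \<rho>S E outs \<Psi> = family_value \<rho>E \<rho>S E outs \<Psi>'"
  unfolding family_value_def by (intro arg_cong[where f = Re] sum.cong refl) (simp add: assms)

lemma limit_families_pure: "unitary U \<Longrightarrow> pure_family (choi_vec U) \<in> limit_families"
  by (simp add: limit_families_def unit_families_pure)

text \<open>The maximum over unitaries exists because the extremal maximizer agrees at level
  \<open>L\<close> with the family of a unitary, while every unitary yields a limit family and so
  cannot exceed it.\<close>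

lemma omega_attained:
  fixes \<rho>E :: "complex^'e::finite^'e" and \<rho>S :: "complex^'s::finite^'s"
  assumes "outs \<noteq> []"
  shows "omega \<rho>E \<rho>S E outs \<in> family_value \<rho>E \<rho>S E outs ` limit_families"
    and "\<And>\<Psi>. \<Psi> \<in> limit_families \<Longrightarrow> family_value \<rho>E \<rho>S E outs \<Psi> \<le> omega \<rho>E \<rho>S E outs"
proof -
  let ?f = "family_value \<rho>E \<rho>S E outs" and ?L = "length outs"
  let ?K = "limit_families :: (('e \<times> 's) \<times> ('e \<times> 's)) list oper set"
  have cont: "continuous_on T ?f" for T by (rule continuous_on_family_value)
  have "unitary (mat 1 :: complex^('e \<times> 's)^('e \<times> 's))"
  proof -
    have "dagger (mat 1) = (mat 1 :: complex^('e \<times> 's)^('e \<times> 's))"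
      by (auto simp: dagger_def mat_def vec_eq_iff)
    then show ?thesis by (simp add: unitary_def)
  qed
  then have "?K \<noteq> {}" using limit_families_pure by blast
  then obtain \<Psi>1 where \<Psi>1: "\<Psi>1 \<in> ?K" "\<And>\<Psi>. \<Psi> \<in> ?K \<Longrightarrow> ?f \<Psi> \<le> ?f \<Psi>1"
    using continuous_attains_sup[OF compact_limit_families _ cont] by blast
  \<comment> \<open>The face of maximizers is again compact, so the largest weight on it is
    attained.\<close>
  let ?F = "?K \<inter> {\<Psi>. ?f \<Psi> = ?f \<Psi>1}"
  have "compact ?F"
    by (intro compact_Int_closed compact_limit_families closed_Collect_eq cont continuous_on_const)
  moreover have "?F \<noteq> {}" using \<Psi>1 by blast
  ultimately have "\<exists>\<Psi>\<in>?F. \<forall>\<Psi>'\<in>?F. level_weight ?L \<Psi>' \<le> level_weight ?L \<Psi>"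
    by (intro continuous_attains_sup continuous_on_level_weight)
  then obtain \<Psi> where \<Psi>: "\<Psi> \<in> ?F" "\<And>\<Psi>'. \<Psi>' \<in> ?F \<Longrightarrow> level_weight ?L \<Psi>' \<le> level_weight ?L \<Psi>"
    by blast
  obtain U where U: "unitary U"
    "\<And>v w. v \<in> words ?L \<Longrightarrow> w \<in> words ?L \<Longrightarrow> \<Psi> v w = pure_family (choi_vec U) v w"
  proof (rule extremal_unitary[of ?f \<Psi> ?L])
    show "?L \<ge> 1" using assms by (cases outs) auto
  qed (use \<Psi> \<Psi>1 in \<open>auto simp: family_value_combination\<close>)
  have val: "?f \<Psi> = outcome_prob \<rho>E \<rho>S E outs U"
    unfolding family_value_pure[OF assms, symmetric] by (rule family_value_cong) (rule U(2))
  have max: "?f \<Psi>' \<le> ?f \<Psi>" if "\<Psi>' \<in> ?K" for \<Psi>'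
    using that \<Psi>(1) \<Psi>1(2) by auto
  have "omega \<rho>E \<rho>S E outs = ?f \<Psi>"
    unfolding omega_def
  proof (rule Greatest_equality)
    show "\<exists>U. unitary U \<and> ?f \<Psi> = outcome_prob \<rho>E \<rho>S E outs U" using U(1) val by blast
    show "r \<le> ?f \<Psi>" if "\<exists>U. unitary U \<and> r = outcome_prob \<rho>E \<rho>S E outs U" for r
      using that max[OF limit_families_pure] by (auto simp flip: family_value_pure[OF assms])
  qed
  with \<Psi>(1) max show "omega \<rho>E \<rho>S E outs \<in> ?f ` ?K"
    "\<And>\<Psi>'. \<Psi>' \<in> ?K \<Longrightarrow> ?f \<Psi>' \<le> omega \<rho>E \<rho>S E outs"
    by (blast, metis)
qed

section \<open>Attained optima and convergence of the hierarchy\<close>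

lemma omega_sdp_attained:
  fixes \<rho>E :: "complex^'e::finite^'e" and \<rho>S :: "complex^'s::finite^'s"
  assumes "outs \<noteq> []" "length outs \<le> N"
  shows "omega_sdp \<rho>E \<rho>S E outs N \<in> family_value \<rho>E \<rho>S E outs ` unit_families N"
    and "\<And>\<Psi>. \<Psi> \<in> unit_families N \<Longrightarrow> family_value \<rho>E \<rho>S E outs \<Psi> \<le> omega_sdp \<rho>E \<rho>S E outs N"
proof -
  let ?f = "family_value \<rho>E \<rho>S E outs"
  let ?K = "unit_families N :: (('e \<times> 's) \<times> ('e \<times> 's)) list oper set"
  have "limit_families \<subseteq> ?K" by (auto simp: limit_families_def)
  then have "?K \<noteq> {}" using omega_attained(1)[OF assms(1), of \<rho>E \<rho>S E] by blast
  then obtain \<Psi> where \<Psi>: "\<Psi> \<in> ?K" "\<And>\<Psi>'. \<Psi>' \<in> ?K \<Longrightarrow> ?f \<Psi>' \<le> ?f \<Psi>"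
    using continuous_attains_sup[OF compact_unit_families _ continuous_on_family_value] by blast
  have "N \<ge> 1" using assms by (cases outs) auto
  note sdp_vals = sdp_values[OF assms(2) this, of \<rho>E \<rho>S E]
  have "omega_sdp \<rho>E \<rho>S E outs N = ?f \<Psi>"
    unfolding omega_sdp_def
  proof (rule Greatest_equality)
    have "?f \<Psi> \<in> ?f ` ?K" using \<Psi>(1) by (rule imageI)
    then show "\<exists>\<Phi>. sdp_feasible N \<Phi> \<and> ?f \<Psi> = sdp_objective \<rho>E \<rho>S E outs N \<Phi>"
      unfolding sdp_vals[symmetric] by (rule CollectD)
    fix r assume "\<exists>\<Phi>. sdp_feasible N \<Phi> \<and> r = sdp_objective \<rho>E \<rho>S E outs N \<Phi>"
    then have "r \<in> ?f ` ?K" unfolding sdp_vals[symmetric] by (rule CollectI)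
    with \<Psi>(2) show "r \<le> ?f \<Psi>" by blast
  qed
  with \<Psi> show "omega_sdp \<rho>E \<rho>S E outs N \<in> ?f ` ?K"
    "\<And>\<Psi>'. \<Psi>' \<in> ?K \<Longrightarrow> ?f \<Psi>' \<le> omega_sdp \<rho>E \<rho>S E outs N"
    by (blast, metis)
qed

lemma compact_nested_Inter_nonempty:
  fixes S :: "nat \<Rightarrow> 'b::t2_space set"
  assumes "\<And>n. compact (S n)" "\<And>n. S n \<noteq> {}" "\<And>m n. m \<le> n \<Longrightarrow> S n \<subseteq> S m"
  shows "(\<Inter>n. S n) \<noteq> {}"
proof -
  have "S 0 \<inter> \<Inter> (range S) \<noteq> {}"
  proof (rule compact_imp_fip)
    show "compact (S 0)" by (rule assms)
    show "closed T" if "T \<in> range S" for T using that assms(1) compact_imp_closed by blast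
    fix F assume F: "finite F" "F \<subseteq> range S"
    then obtain I where I: "finite I" "F = S ` I" by (meson finite_subset_image)
    obtain n where "\<forall>i\<in>I. i \<le> n" using I(1) finite_nat_set_iff_bounded_le by auto
    then have "S n \<subseteq> S 0 \<inter> \<Inter> F" using assms(3) I(2) by blast
    then show "S 0 \<inter> \<Inter> F \<noteq> {}" using assms(2)[of n] by blast
  qed
  then show ?thesis by blast
qed

text \<open>With c the limit of the decreasing maxima, the parts of the sets where \<open>f\<close>
  is at least c are nonempty, compact and nested. A common point lies in the intersection and shows
  that c is at most \<open>b\<close>.\<close>

lemma tendsto_max_nested_compact:
  fixes S :: "nat \<Rightarrow> 'b::t2_space set" and f :: "'b \<Rightarrow> real"
  assumes S: "\<And>n. compact (S n)" "\<And>m n. m \<le> n \<Longrightarrow> S n \<subseteq> S m"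
    and cont: "continuous_on UNIV f"
    and a: "\<And>n. a n \<in> f ` S n" "\<And>n x. x \<in> S n \<Longrightarrow> f x \<le> a n"
    and b: "b \<in> f ` (\<Inter>n. S n)" "\<And>x. x \<in> (\<Inter>n. S n) \<Longrightarrow> f x \<le> b"
  shows "a \<longlonglongrightarrow> b"
proof -
  have dec: "decseq a"
  proof (rule decseq_SucI)
    show "a (Suc n) \<le> a n" for n using a(1)[of "Suc n"] a(2)[of _ n] S(2)[of n "Suc n"] by auto
  qed
  have ba: "b \<le> a n" for n using a b(1) by auto
  obtain c where c: "a \<longlonglongrightarrow> c" "\<And>n. c \<le> a n"
    using decseq_convergent[OF dec, of b] ba by auto
  have "(\<Inter>n. S n \<inter> {x. c \<le> f x}) \<noteq> {}"
  proof (rule compact_nested_Inter_nonempty)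
    show "compact (S n \<inter> {x. c \<le> f x})" for n
      by (intro compact_Int_closed S closed_Collect_le cont continuous_on_const)
    show "S n \<inter> {x. c \<le> f x} \<noteq> {}" for n
      using a(1)[of n] c(2)[of n] by auto
    show "S n \<inter> {x. c \<le> f x} \<subseteq> S m \<inter> {x. c \<le> f x}" if "m \<le> n" for m n
      using S(2)[OF that] by blast
  qed
  then obtain x where "x \<in> (\<Inter>n. S n)" "c \<le> f x" by blast
  then have "c \<le> b" using b(2) by fastforce
  moreover have "b \<le> c" using c(1) ba by (intro LIMSEQ_le_const) auto
  ultimately show ?thesis using c(1) by simp
qed

theorem mainTheorem1:
  fixes \<rho>E :: "complex^'e::finite^'e"
    and \<rho>S :: "complex^'s::finite^'s"
    and \<A> :: "'a set"
    and E :: "'a \<Rightarrow> complex^'s^'s"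
    and outs :: "'a list"
    and L :: nat
  assumes "density_op \<rho>E"
    and "density_op \<rho>S"
    and "povm \<A> E"
    and "set outs \<subseteq> \<A>"
    and "length outs = L"
    and "L \<ge> 1"
  shows "(\<forall>N\<ge>L. omega \<rho>E \<rho>S E outs \<le> omega_sdp \<rho>E \<rho>S E outs (N + 1)
              \<and> omega_sdp \<rho>E \<rho>S E outs (N + 1) \<le> omega_sdp \<rho>E \<rho>S E outs N)
         \<and> (\<lambda>N. omega_sdp \<rho>E \<rho>S E outs N) \<longlonglongrightarrow> omega \<rho>E \<rho>S E outs"
proof -
  let ?f = "family_value \<rho>E \<rho>S E outs" and ?K = "unit_families :: nat \<Rightarrow> (('e \<times> 's) \<times> ('e \<times> 's)) list oper set"
  have ne: "outs \<noteq> []" using assms(5,6) by auto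
  note om = omega_attained[OF ne, where \<rho>E = \<rho>E and \<rho>S = \<rho>S and E = E]
  note sdp = omega_sdp_attained[OF ne, where \<rho>E = \<rho>E and \<rho>S = \<rho>S and E = E]
  have lower: "omega \<rho>E \<rho>S E outs \<le> omega_sdp \<rho>E \<rho>S E outs N" if "N \<ge> L" for N
    using om(1) sdp(2)[of N] that assms(5) by (auto simp: limit_families_def)
  have decreasing: "omega_sdp \<rho>E \<rho>S E outs (N + 1) \<le> omega_sdp \<rho>E \<rho>S E outs N" if "N \<ge> L" for N
    using sdp(1)[of "N + 1"] sdp(2)[of N] that assms(5) unit_families_mono[of N "N + 1"] by auto
  \<comment> \<open>The description by families holds from level \<open>L\<close> on, so the
    sequence is shifted; nestedness leaves the intersection unchanged.\<close>
  have "(\<lambda>N. omega_sdp \<rho>E \<rho>S E outs (N + L)) \<longlonglongrightarrow> omega \<rho>E \<rho>S E outs"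
  proof (rule tendsto_max_nested_compact)
    have "(\<Inter>N. ?K (N + L)) = limit_families"
      unfolding limit_families_def using unit_families_mono[OF le_add1] by blast
    then show "omega \<rho>E \<rho>S E outs \<in> ?f ` (\<Inter>N. ?K (N + L))"
      and "\<And>\<Psi>. \<Psi> \<in> (\<Inter>N. ?K (N + L)) \<Longrightarrow> ?f \<Psi> \<le> omega \<rho>E \<rho>S E outs"
      using om by auto
    show "continuous_on UNIV ?f" by (rule continuous_on_family_value)
    show "?K (n + L) \<subseteq> ?K (m + L)" if "m \<le> n" for m n
      using that by (intro unit_families_mono) simp
    show "omega_sdp \<rho>E \<rho>S E outs (N + L) \<in> ?f ` ?K (N + L)" for N
      using assms(5) by (intro sdp(1)) simp
    show "?f \<Psi> \<le> omega_sdp \<rho>E \<rho>S E outs (N + L)" if "\<Psi> \<in> ?K (N + L)" for N \<Psi>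
      using assms(5) that by (intro sdp(2)) simp_all
  qed (rule compact_unit_families)
  then have "(\<lambda>N. omega_sdp \<rho>E \<rho>S E outs N) \<longlonglongrightarrow> omega \<rho>E \<rho>S E outs"
    by (rule LIMSEQ_offset)
  moreover have "omega \<rho>E \<rho>S E outs \<le> omega_sdp \<rho>E \<rho>S E outs (N + 1)" if "N \<ge> L" for N
    using that by (intro lower) simp
  ultimately show ?thesis using decreasing by blast
qed

end
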